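(* Let $P$ be a computable probability measure on the binary tree. Let $\omega$ be an infinite binary sequence that is Martin-Löf random with respect to $P$, and let $D=d(\omega\mid P)$. Then \[ \sum_{x\text{ a prefix of }\omega}\bigl(H(0\mid x)-P(0\mid x)\bigr)^2=O\Bigl((K(P)+D)\cdot 2^{\frac{3K(P)+D+O(1)}{2}}\Bigr), \] where the constants in $O(\cdot)$ do not depend on $P$ or $\omega$.
   Context: A measure on the binary tree is a function $P:\{0,1\}^*\to\mathbb{R}_{\ge 0}$ with rational values such that $P(\text{empty word})=1$ and $P(x0)+P(x1)=P(x)$ for every string $x$. It is computable if some algorithm outputs $P(x)$ on input $x$. Conditional probabilities are $P(b\mid x)=P(xb)/P(x)$. $K$ denotes prefix complexity, and $K(Q)$ for a computable measure $Q$ is the minimal prefix complexity of a program computing $Q$. Logarithms are binary. A semimeasure is a function $S:\{0,1\}^*\to\mathbb{R}_{\ge0}$ with $S(\text{empty word})\le 1$ and $S(x0)+S(x1)\le S(x)$ for every $x$. $M$ is a fixed universal lower semicomputable semimeasure, i.e. for every lower semicomputable semimeasure $S$ there is $c>0$ with $M(x)\ge cS(x)$ for all $x$. The a priori complexity is $KA(x)=\lceil -\log M(x)\rceil$. The randomness deficiency of a string is $d(x\mid P)=-\log P(x)-KA(x)$, and for an infinite sequence $d(\omega\mid P)=\sup_{x\text{ prefix of }\omega} d(x\mid P)$; it is finite for $P$-Martin-Löf random $\omega$. For a string $x$, a best explanation of $x$ is a computable measure $Q$ minimizing $3K(Q)-\log Q(x)$ over all computable measures; any one minimizer is chosen. The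 prediction is $H(b\mid x)=Q(xb)/Q(x)$ for this $Q$.
   Formalization: The factor K(P)+D in the bound is read as max(1, K(P)+D), since for some choices of the universal semimeasure M the quantity K(P)+D can be zero or negative while the sum is positive. *)

theory Defs
  imports "HOL-Analysis.Analysis" "HOL-Library.Nat_Bijection"
begin

datatype recf = Zr | Sc | Pr nat | Cn recf "recf list" | Pm recf recf | Mn recf

inductive eval :: "recf \<Rightarrow> nat list \<Rightarrow> nat \<Rightarrow> bool" where
  ev_zero: "eval Zr xs 0"
| ev_succ: "eval Sc (x # xs) (Suc x)"
| ev_proj: "i < length xs \<Longrightarrow> eval (Pr i) xs (xs ! i)"
| ev_comp: "list_all2 (\<lambda>g y. eval g xs y) gs ys \<Longrightarrow> eval f ys z \<Longrightarrow> eval (Cn f gs) xs z"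
| ev_prim0: "eval f xs z \<Longrightarrow> eval (Pm f g) (0 # xs) z"
| ev_primS: "eval (Pm f g) (n # xs) y \<Longrightarrow> eval g (y # n # xs) z \<Longrightarrow> eval (Pm f g) (Suc n # xs) z"
| ev_mu: "eval f (n # xs) 0 \<Longrightarrow> (\<forall>m<n. \<exists>k. eval f (m # xs) (Suc k)) \<Longrightarrow> eval (Mn f) xs n"

fun code :: "recf \<Rightarrow> nat" where
  "code Zr = list_encode [0]"
| "code Sc = list_encode [1]"
| "code (Pr i) = list_encode [2, i]"
| "code (Cn f gs) = list_encode (3 # code f # map code gs)"
| "code (Pm f g) = list_encode [4, code f, code g]"
| "code (Mn f) = list_encode [5, code f]"

text \<open>Bijective encoding of binary strings as natural numbers.\<close>
fun benc :: "bool list \<Rightarrow> nat" where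
  "benc [] = 0"
| "benc (b # xs) = (if b then 2 else 1) + 2 * benc xs"

definition rat_of_code :: "nat \<Rightarrow> rat" where
  "rat_of_code n = (case prod_decode n of (a, b) \<Rightarrow> of_nat a / of_nat (Suc b))"

definition run :: "recf \<Rightarrow> bool list \<Rightarrow> bool list option" where
  "run r p = (if \<exists>y. eval r [benc p] (benc y) then Some (THE y. eval r [benc p] (benc y)) else None)"

definition prefix_free_machine :: "(bool list \<Rightarrow> bool list option) \<Rightarrow> bool" where
  "prefix_free_machine F \<longleftrightarrow> (\<exists>r. F = run r) \<and>
     (\<forall>p q w. F p \<noteq> None \<longrightarrow> F q \<noteq> None \<longrightarrow> q = p @ w \<longrightarrow> p = q)"

definition optimal_machine :: "(bool list \<Rightarrow> bool list option) \<Rightarrow> bool" where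
  "optimal_machine U \<longleftrightarrow> prefix_free_machine U \<and>
     (\<forall>V. prefix_free_machine V \<longrightarrow>
        (\<exists>c. \<forall>x q. V q = Some x \<longrightarrow> (\<exists>p. U p = Some x \<and> length p \<le> length q + c)))"

definition is_measure :: "(bool list \<Rightarrow> rat) \<Rightarrow> bool" where
  "is_measure P \<longleftrightarrow> P [] = 1 \<and> (\<forall>x. P x \<ge> 0) \<and> (\<forall>x. P (x @ [False]) + P (x @ [True]) = P x)"

definition computes :: "recf \<Rightarrow> (bool list \<Rightarrow> rat) \<Rightarrow> bool" where
  "computes r Q \<longleftrightarrow> (\<forall>x. \<exists>n. eval r [benc x] n \<and> rat_of_code n = Q x)"

definition computable_measure :: "(bool list \<Rightarrow> rat) \<Rightarrow> bool" where
  "computable_measure Q \<longleftrightarrow> is_measure Q \<and> (\<exists>r. computes r Q)"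

definition KQ :: "(bool list \<Rightarrow> bool list option) \<Rightarrow> (bool list \<Rightarrow> rat) \<Rightarrow> nat" where
  "KQ U Q = (LEAST k. \<exists>r p s. computes r Q \<and> benc s = code r \<and> U p = Some s \<and> length p = k)"

definition cond :: "(bool list \<Rightarrow> rat) \<Rightarrow> bool \<Rightarrow> bool list \<Rightarrow> real" where
  "cond Q b x = real_of_rat (Q (x @ [b])) / real_of_rat (Q x)"

definition semimeasure :: "(bool list \<Rightarrow> real) \<Rightarrow> bool" where
  "semimeasure S \<longleftrightarrow> S [] \<le> 1 \<and> (\<forall>x. S x \<ge> 0) \<and> (\<forall>x. S (x @ [False]) + S (x @ [True]) \<le> S x)"

definition lower_semicomputable :: "(bool list \<Rightarrow> real) \<Rightarrow> bool" where
  "lower_semicomputable S \<longleftrightarrow> (\<exists>g r. (\<forall>t x. \<exists>n. eval r [t, benc x] n \<and> rat_of_code n = g t x) \<and>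
     (\<forall>x. (\<forall>t. real_of_rat (g t x) \<le> S x) \<and> (\<forall>e>0. \<exists>t. S x - e < real_of_rat (g t x))))"

definition universal_semimeasure :: "(bool list \<Rightarrow> real) \<Rightarrow> bool" where
  "universal_semimeasure M \<longleftrightarrow> semimeasure M \<and> lower_semicomputable M \<and>
     (\<forall>S. semimeasure S \<and> lower_semicomputable S \<longrightarrow> (\<exists>c>0. \<forall>x. M x \<ge> c * S x))"

definition KA :: "(bool list \<Rightarrow> real) \<Rightarrow> bool list \<Rightarrow> int" where
  "KA M x = \<lceil>- log 2 (M x)\<rceil>"

definition defic :: "(bool list \<Rightarrow> real) \<Rightarrow> (bool list \<Rightarrow> rat) \<Rightarrow> bool list \<Rightarrow> real" where
  "defic M P x = - log 2 (real_of_rat (P x)) - real_of_int (KA M x)"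

definition pref :: "(nat \<Rightarrow> bool) \<Rightarrow> nat \<Rightarrow> bool list" where
  "pref \<omega> n = map \<omega> [0..<n]"

definition seq_defic :: "(bool list \<Rightarrow> real) \<Rightarrow> (bool list \<Rightarrow> rat) \<Rightarrow> (nat \<Rightarrow> bool) \<Rightarrow> real" where
  "seq_defic M P \<omega> = (SUP n. defic M P (pref \<omega> n))"

text \<open>P-measure of the open set generated by a set W of strings.\<close>
definition open_measure :: "(bool list \<Rightarrow> rat) \<Rightarrow> bool list set \<Rightarrow> real" where
  "open_measure P W = Sup {(\<Sum>a\<in>A. real_of_rat (P a)) | A. finite A \<and>
      (\<forall>a\<in>A. \<forall>b\<in>A. (\<exists>w. b = a @ w) \<longrightarrow> a = b) \<and> (\<forall>a\<in>A. \<exists>w\<in>W. \<exists>v. a = w @ v)}"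

definition mlof_test :: "(bool list \<Rightarrow> rat) \<Rightarrow> (nat \<Rightarrow> bool list set) \<Rightarrow> bool" where
  "mlof_test P T \<longleftrightarrow> (\<exists>r. \<forall>n x. x \<in> T n \<longleftrightarrow> (\<exists>y. eval r [n, benc x] y)) \<and>
     (\<forall>n. open_measure P (T n) \<le> (1/2) ^ n)"

definition mlof_random :: "(bool list \<Rightarrow> rat) \<Rightarrow> (nat \<Rightarrow> bool) \<Rightarrow> bool" where
  "mlof_random P \<omega> \<longleftrightarrow> (\<forall>T. mlof_test P T \<longrightarrow> \<not> (\<forall>n. \<exists>k. pref \<omega> k \<in> T n))"

definition expl_score :: "(bool list \<Rightarrow> bool list option) \<Rightarrow> bool list \<Rightarrow> (bool list \<Rightarrow> rat) \<Rightarrow> real" where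
  "expl_score U x Q = 3 * real (KQ U Q) - log 2 (real_of_rat (Q x))"

definition best_expl :: "(bool list \<Rightarrow> bool list option) \<Rightarrow> bool list \<Rightarrow> (bool list \<Rightarrow> rat) \<Rightarrow> bool" where
  "best_expl U x Q \<longleftrightarrow> computable_measure Q \<and> Q x > 0 \<and>
     (\<forall>Q'. computable_measure Q' \<and> Q' x > 0 \<longrightarrow> expl_score U x Q \<le> expl_score U x Q')"

end

theory Submission
  imports Defs
begin

text \<open>
  Let Q be the best explanation of a prefix x of \<open>\<omega>\<close>. The universal semimeasure M dominates
  \<open>2 ^ - K(Q) * Q\<close>, and \<open>M x \<le> 2 ^ (D + 1) * P x\<close>, so minimality of the score of Q gives
  \<open>2 * K(Q) \<le> 3 * K(P) + D + O(1)\<close>: this bounds the number of explanations that ever occur.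

  For each single Q, let R be the semimeasure whose conditional probabilities are the averages of
  those of P and Q. M also dominates \<open>2 ^ - (K(P) + K(Q)) * R\<close>, whereas strict concavity of the
  logarithm makes R exceed the geometric mean of P and Q along \<open>\<omega>\<close> by a factor exponential in the
  sum of \<open>(P(0|y) - Q(0|y))\<^sup>2\<close>. At the last x explained by Q this sum is therefore \<open>O(K(P) + D)\<close>.

  Both domination statements need a universal program. Evaluation of program codes is shown to be
  a \<open>\<Sigma>\<^sub>1\<close> relation because evaluations are witnessed by finite derivations, and a \<open>\<Sigma>\<^sub>1\<close> family of
  values yields a lower semicomputable weighted sum.
\<close>

section \<open>Computable functions and relations\<close>

text \<open>The factor 3 in the score is spent twice. Write k = K(Q), K = K(P), q = Q x, p = P x.
  Domination gives log q - k <= log p + D + O(1), and adding 3k - log q <= 3K - log p leaves 2k on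
  the left; this is the source of the exponent. In the second estimate the geometric mean loses (log
  p - log q) / 2, at most 3/2 (K - k), while the weight of R costs K + k. The total is 5/2 K - k/2 +
  D + O(1): since 3/2 exceeds 1, k drops out and the bound is uniform in Q. The obstacle on the
  computability side is that an enumerated program need not be total, let alone compute a measure,
  and this cannot be decided. Programs are therefore released string by string behind a
  semidecidable check, and every value not yet confirmed counts as 0. Values are exact rationals, so
  the conditional probabilities in R can be tabulated exactly instead of being approximated.\<close>

lemma eval_CnI1: "eval g xs y \<Longrightarrow> eval f [y] z \<Longrightarrow> eval (Cn f [g]) xs z"
  by (rule ev_comp[where ys="[y]"]) auto

lemma eval_CnI2: "eval g xs y \<Longrightarrow> eval h xs y' \<Longrightarrow> eval f [y, y'] z \<Longrightarrow> eval (Cn f [g, h]) xs z"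
  by (rule ev_comp[where ys="[y, y']"]) auto

lemma eval_PrI: "i < length xs \<Longrightarrow> y = xs ! i \<Longrightarrow> eval (Pr i) xs y"
  by (simp add: ev_proj)

lemma eval_ScI: "y = Suc x \<Longrightarrow> eval Sc [x] y"
  by (simp add: ev_succ)

section \<open>Programs for arithmetic and Cantor pairing\<close>

definition add_recf :: recf where "add_recf = Pm (Pr 0) (Cn Sc [Pr 0])"
definition mult_recf :: recf where "mult_recf = Pm Zr (Cn add_recf [Pr 0, Pr 2])"
definition pred_recf :: recf where "pred_recf = Pm Zr (Pr 1)"
text \<open>The arguments are reversed, \<open>[m, n]\<close> giving \<open>n - m\<close>, because
  \<open>Pm\<close> recurses on its first argument and the subtrahend counts the predecessor
  steps.\<close>

definition rsub_recf :: recf where "rsub_recf = Pm (Pr 0) (Cn pred_recf [Pr 0])"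
definition tri_recf :: recf where "tri_recf = Pm Zr (Cn add_recf [Pr 0, Cn Sc [Pr 1]])"
definition pair_recf :: recf where "pair_recf = Cn add_recf [Cn tri_recf [add_recf], Pr 0]"
text \<open>Searches for the first \<open>s\<close> with \<open>n < triangle (Suc s)\<close>. Since
  \<open>prod_encode (a, b) = triangle (a + b) + a\<close>, this is the diagonal
  \<open>a + b\<close> on which \<open>n\<close> lies, and both projections follow from it by
  subtraction.\<close>

definition diag_recf :: recf where
  "diag_recf = Mn (Cn rsub_recf [Cn tri_recf [Cn Sc [Pr 0]], Cn Sc [Pr 1]])"

lemma eval_add: "eval add_recf [m, n] (m + n)"
  unfolding add_recf_def
proof (induction m)
  case 0 show ?case by (auto intro!: ev_prim0 eval_PrI)
next
  case (Suc m)
  have "eval (Cn Sc [Pr 0]) [m + n, m, n] (Suc (m + n))"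
    by (rule eval_CnI1[OF eval_PrI eval_ScI]) auto
  with Suc show ?case by (auto intro: ev_primS)
qed

lemma eval_mult: "eval mult_recf [m, n] (m * n)"
proof (induction m)
  case 0 show ?case unfolding mult_recf_def by (auto intro!: ev_prim0 ev_zero)
next
  case (Suc m)
  have "eval (Cn add_recf [Pr 0, Pr 2]) [m * n, m, n] (m * n + n)"
    by (rule eval_CnI2[OF eval_PrI eval_PrI eval_add]) auto
  with Suc show ?case unfolding mult_recf_def by (auto intro: ev_primS simp: add.commute)
qed

lemma eval_pred: "eval pred_recf [n] (n - 1)"
proof (induction n)
  case 0 show ?case unfolding pred_recf_def by (auto intro!: ev_prim0 ev_zero)
next
  case (Suc n) thus ?case unfolding pred_recf_def by (auto intro!: ev_primS eval_PrI)
qed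

lemma eval_rsub: "eval rsub_recf [m, n] (n - m)"
proof (induction m)
  case 0 show ?case unfolding rsub_recf_def by (auto intro!: ev_prim0 eval_PrI)
next
  case (Suc m)
  have "eval (Cn pred_recf [Pr 0]) [n - m, m, n] (n - m - 1)"
    by (rule eval_CnI1[OF eval_PrI eval_pred]) auto
  with Suc show ?case unfolding rsub_recf_def by (auto intro: ev_primS)
qed

lemma eval_tri: "eval tri_recf [n] (triangle n)"
proof (induction n)
  case 0 show ?case unfolding tri_recf_def by (auto intro!: ev_prim0 ev_zero)
next
  case (Suc n)
  have "eval (Cn add_recf [Pr 0, Cn Sc [Pr 1]]) [triangle n, n] (triangle n + Suc n)"
    by (rule eval_CnI2[OF eval_PrI eval_CnI1[OF eval_PrI eval_ScI] eval_add]) auto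
  with Suc show ?case unfolding tri_recf_def by (auto intro: ev_primS)
qed

lemma eval_pair: "eval pair_recf [m, n] (prod_encode (m, n))"
  unfolding pair_recf_def prod_encode_def
  by (auto intro!: eval_CnI2[OF _ _ eval_add] eval_CnI1[OF eval_add eval_tri] eval_PrI)

definition pfst :: "nat \<Rightarrow> nat" where "pfst n = fst (prod_decode n)"
definition psnd :: "nat \<Rightarrow> nat" where "psnd n = snd (prod_decode n)"

lemma pfst_pair [simp]: "pfst (prod_encode (a, b)) = a"
  and psnd_pair [simp]: "psnd (prod_encode (a, b)) = b"
  by (auto simp: pfst_def psnd_def)

lemma pair_collapse [simp]: "prod_encode (pfst n, psnd n) = n"
  by (simp add: pfst_def psnd_def)

lemma triangle_mono: "m \<le> n \<Longrightarrow> triangle m \<le> triangle n"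
  by (induction n) (auto simp: le_Suc_eq)

lemma eval_diag: "eval diag_recf [n] (pfst n + psnd n)"
proof -
  define s where "s = pfst n + psnd n"
  have n: "n = triangle s + pfst n"
    using pair_collapse[of n] unfolding prod_encode_def s_def by simp
  have *: "eval (Cn rsub_recf [Cn tri_recf [Cn Sc [Pr 0]], Cn Sc [Pr 1]]) [m, n]
             (Suc n - triangle (Suc m))" for m
    by (rule eval_CnI2[OF eval_CnI1[OF eval_CnI1[OF eval_PrI eval_ScI] eval_tri]
         eval_CnI1[OF eval_PrI eval_ScI] eval_rsub]) auto
  have "Suc n - triangle (Suc s) = 0" using n by (simp add: s_def)
  moreover have "\<exists>k. Suc n - triangle (Suc m) = Suc k" if "m < s" for m
  proof -
    have "triangle (Suc m) \<le> triangle s" using that by (intro triangle_mono) auto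
    hence "Suc n - triangle (Suc m) \<noteq> 0" using n by linarith
    thus ?thesis by (metis not0_implies_Suc)
  qed
  ultimately show ?thesis unfolding diag_recf_def s_def[symmetric]
    by (intro ev_mu) (metis *)+
qed

text \<open>Unary functions suffice, as several arguments are packed into one environment number.\<close>
definition computable :: "(nat \<Rightarrow> nat) \<Rightarrow> bool" where
  "computable f \<longleftrightarrow> (\<exists>r. \<forall>x. eval r [x] (f x))"

lemma comp_unary:
  assumes "\<And>x. eval r [x] (F x)" "computable f"
  shows "computable (\<lambda>e. F (f e))"
proof -
  obtain s where "\<And>x. eval s [x] (f x)" using assms(2) unfolding computable_def by blast
  hence "eval (Cn r [s]) [x] (F (f x))" for x using assms(1) by (auto intro: eval_CnI1)
  thus ?thesis unfolding computable_def by blast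
qed

lemma comp_binary:
  assumes "\<And>x y. eval r [x, y] (F x y)" "computable f" "computable g"
  shows "computable (\<lambda>e. F (f e) (g e))"
proof -
  obtain s where s: "\<And>x. eval s [x] (f x)" using assms(2) unfolding computable_def by blast
  obtain t where t: "\<And>x. eval t [x] (g x)" using assms(3) unfolding computable_def by blast
  have "eval (Cn r [s, t]) [x] (F (f x) (g x))" for x
    by (rule eval_CnI2[OF s t assms(1)])
  thus ?thesis unfolding computable_def by blast
qed

lemma comp_subst: "computable F \<Longrightarrow> computable f \<Longrightarrow> computable (\<lambda>e. F (f e))"
  using comp_unary unfolding computable_def by blast

lemma comp_id: "computable (\<lambda>e. e)"
  unfolding computable_def by (intro exI[of _ "Pr 0"]) (auto intro: eval_PrI)

lemma comp_Suc: "computable f \<Longrightarrow> computable (\<lambda>e. Suc (f e))"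
  by (rule comp_unary[where F=Suc]) (rule eval_ScI, simp)

lemma comp_const: "computable (\<lambda>_. c)"
proof (induction c)
  case 0 show ?case unfolding computable_def by (intro exI[of _ Zr]) (auto intro: ev_zero)
qed (rule comp_Suc)

lemma comp_add: "computable f \<Longrightarrow> computable g \<Longrightarrow> computable (\<lambda>e. f e + g e)"
  by (rule comp_binary[OF eval_add])

lemma comp_mult: "computable f \<Longrightarrow> computable g \<Longrightarrow> computable (\<lambda>e. f e * g e)"
  by (rule comp_binary[OF eval_mult])

lemma comp_diff: "computable f \<Longrightarrow> computable g \<Longrightarrow> computable (\<lambda>e. f e - g e)"
  using comp_binary[OF eval_rsub, of g f] by simp

lemma comp_pair: "computable f \<Longrightarrow> computable g \<Longrightarrow> computable (\<lambda>e. prod_encode (f e, g e))"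
  by (rule comp_binary[OF eval_pair])

lemma comp_pfst: assumes "computable f" shows "computable (\<lambda>e. pfst (f e))"
proof -
  have "eval (Cn rsub_recf [Cn tri_recf [diag_recf], Pr 0]) [n] (n - triangle (pfst n + psnd n))" for n
    by (rule eval_CnI2[OF eval_CnI1[OF eval_diag eval_tri] eval_PrI eval_rsub]) auto
  moreover have "n - triangle (pfst n + psnd n) = pfst n" for n
    using pair_collapse[of n] unfolding prod_encode_def by auto
  ultimately have "computable pfst" unfolding computable_def by metis
  thus ?thesis using assms by (rule comp_subst)
qed

lemma comp_psnd: assumes "computable f" shows "computable (\<lambda>e. psnd (f e))"
proof -
  have "computable (\<lambda>n. (pfst n + psnd n) - pfst n)"
    by (intro comp_diff comp_pfst comp_unary[OF eval_diag] comp_id)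
  thus ?thesis using assms by (auto intro: comp_subst)
qed

lemma comp_rec:
  assumes f: "computable f" and g: "computable (\<lambda>e. g (pfst e) (pfst (psnd e)) (psnd (psnd e)))" and n: "computable n"
  shows "computable (\<lambda>e. rec_nat (f e) (\<lambda>k y. g y k e) (n e))"
proof -
  obtain rf where rf: "\<And>x. eval rf [x] (f x)" using f unfolding computable_def by blast
  obtain rg where rg: "\<And>x. eval rg [x] (g (pfst x) (pfst (psnd x)) (psnd (psnd x)))"
    using g unfolding computable_def by blast
  define rg' where "rg' = Cn rg [Cn pair_recf [Pr 0, Cn pair_recf [Pr 1, Pr 2]]]"
  have rg': "eval rg' [y, k, e] (g y k e)" for y k e
  proof -
    have "eval (Cn pair_recf [Pr 0, Cn pair_recf [Pr 1, Pr 2]]) [y, k, e]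
            (prod_encode (y, prod_encode (k, e)))"
      by (rule eval_CnI2[OF eval_PrI eval_CnI2[OF eval_PrI eval_PrI eval_pair] eval_pair]) auto
    from eval_CnI1[OF this rg] show ?thesis by (simp add: rg'_def)
  qed
  have "eval (Pm rf rg') [k, e] (rec_nat (f e) (\<lambda>k y. g y k e) k)" for k e
    by (induction k) (auto intro: ev_prim0 ev_primS rf rg')
  from comp_binary[OF this n comp_id] show ?thesis .
qed

text \<open>The value 0 stands for truth, which is what minimization searches for.\<close>
definition dec :: "(nat \<Rightarrow> bool) \<Rightarrow> bool" where
  "dec P \<longleftrightarrow> computable (\<lambda>e. if P e then 0 else Suc 0)"

text \<open>Case distinction is recursion on the truth value: at 0 the base value survives, at 1 the
  only recursion step replaces it.\<close>

lemma comp_if: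
  assumes "dec P" "computable f" "computable g"
  shows "computable (\<lambda>e. if P e then f e else g e)"
proof -
  have "computable (\<lambda>e. rec_nat (f e) (\<lambda>k y. g e) (if P e then 0 else Suc 0))"
    using assms unfolding dec_def by (intro comp_rec comp_subst[OF assms(3)] comp_psnd comp_id) auto
  moreover have "rec_nat (f e) (\<lambda>k y. g e) (if P e then 0 else Suc 0) = (if P e then f e else g e)" for e
    by simp
  ultimately show ?thesis by simp
qed

lemma dec_not: assumes "dec P" shows "dec (\<lambda>e. \<not> P e)"
proof -
  have "computable (\<lambda>e. if P e then Suc 0 else 0)" by (intro comp_if assms comp_const)
  moreover have "(\<lambda>e. if P e then Suc 0 else 0) = (\<lambda>e. if \<not> P e then 0 else Suc 0)" by auto
  ultimately show ?thesis unfolding dec_def by simp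
qed

lemma dec_conj: assumes "dec P" "dec Q" shows "dec (\<lambda>e. P e \<and> Q e)"
proof -
  have "computable (\<lambda>e. if P e then if Q e then 0 else Suc 0 else Suc 0)"
    by (intro comp_if assms comp_const)
  moreover have "(\<lambda>e. if P e then if Q e then 0 else Suc 0 else Suc 0) =
    (\<lambda>e. if P e \<and> Q e then 0 else Suc 0)" by auto
  ultimately show ?thesis unfolding dec_def by simp
qed

lemma dec_disj: "dec P \<Longrightarrow> dec Q \<Longrightarrow> dec (\<lambda>e. P e \<or> Q e)"
  using dec_not[OF dec_conj[OF dec_not dec_not]] by simp

lemma dec_le: assumes "computable f" "computable g" shows "dec (\<lambda>e. f e \<le> g e)"
proof -
  have "computable (\<lambda>e. Suc 0 - (Suc 0 - (f e - g e)))"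
    by (intro comp_diff comp_const assms)
  moreover have "Suc 0 - (Suc 0 - (f e - g e)) = (if f e \<le> g e then 0 else Suc 0)" for e by auto
  ultimately show ?thesis unfolding dec_def by simp
qed

lemma dec_less: "computable f \<Longrightarrow> computable g \<Longrightarrow> dec (\<lambda>e. f e < g e)"
  using dec_not[OF dec_le, of g f] by (simp add: not_le)

lemma dec_eq: "computable f \<Longrightarrow> computable g \<Longrightarrow> dec (\<lambda>e. f e = g e)"
  using dec_conj[OF dec_le dec_le, of f g g f] by (simp add: order_eq_iff)

lemma dec_subst: "dec P \<Longrightarrow> computable f \<Longrightarrow> dec (\<lambda>e. P (f e))"
  unfolding dec_def by (rule comp_subst)

text \<open>The second conclusion exposes the body of the search, so that
  \<open>sigma1_domain\<close> can also argue backwards from halting to a witness.\<close>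

lemma eval_Mn_dec:
  assumes "dec (\<lambda>e. Q (pfst e) (psnd e))"
  obtains r where "\<And>e. \<exists>m. Q m e \<Longrightarrow> eval (Mn r) [e] (LEAST m. Q m e)"
    and "\<And>e n. eval r [n, e] (if Q n e then 0 else Suc 0)"
proof -
  obtain s where s: "\<And>x. eval s [x] (if Q (pfst x) (psnd x) then 0 else Suc 0)"
    using assms unfolding dec_def computable_def by blast
  define r where "r = Cn s [Cn pair_recf [Pr 0, Pr 1]]"
  have "eval (Cn pair_recf [Pr 0, Pr 1]) [n, e] (prod_encode (n, e))" for n e
    by (rule eval_CnI2[OF eval_PrI eval_PrI eval_pair]) auto
  from eval_CnI1[OF this s]
  have r: "eval r [n, e] (if Q n e then 0 else Suc 0)" for n e unfolding r_def by simp
  have "eval (Mn r) [e] (LEAST m. Q m e)" if "\<exists>m. Q m e" for e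
  proof (intro ev_mu allI impI)
    show "eval r [LEAST m. Q m e, e] 0" using r[of "LEAST m. Q m e" e] LeastI_ex[OF that] by simp
  next
    fix m assume "m < (LEAST m. Q m e)"
    hence "\<not> Q m e" by (rule not_less_Least)
    thus "\<exists>k. eval r [m, e] (Suc k)" using r[of m e] by (auto simp only: if_False)
  qed
  thus ?thesis using r that by blast
qed

lemma comp_Least:
  assumes "dec (\<lambda>e. Q (pfst e) (psnd e))" "\<And>e. \<exists>m. Q m e"
  shows "computable (\<lambda>e. LEAST m. Q m e)"
  using eval_Mn_dec[OF assms(1)] assms(2) unfolding computable_def by metis

text \<open>The search for a counterexample is made total by letting it stop at the bound as well;
  the quantifier holds exactly if the search gets as far as the bound.\<close>

lemma dec_all_less:
  assumes Q: "dec (\<lambda>e. Q (pfst e) (psnd e))" and b: "computable b"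
  shows "dec (\<lambda>e. \<forall>m < b e. Q m e)"
proof -
  have ex: "\<exists>m. b e \<le> m \<or> \<not> Q m e" for e by blast
  have "computable (\<lambda>e. LEAST m. b e \<le> m \<or> \<not> Q m e)"
    by (intro comp_Least ex dec_disj dec_not Q dec_le comp_subst[OF b] comp_psnd comp_pfst comp_id)
  hence "dec (\<lambda>e. b e \<le> (LEAST m. b e \<le> m \<or> \<not> Q m e))" by (intro dec_le b)
  moreover have "b e \<le> (LEAST m. b e \<le> m \<or> \<not> Q m e) \<longleftrightarrow> (\<forall>m < b e. Q m e)" for e
    using LeastI_ex[OF ex, of e] not_less_Least[of _ "\<lambda>m. b e \<le> m \<or> \<not> Q m e"]
    by (meson leI not_le order.strict_trans2)
  ultimately show ?thesis by simp
qed

lemma dec_ex_less: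
  assumes "dec (\<lambda>e. Q (pfst e) (psnd e))" "computable b"
  shows "dec (\<lambda>e. \<exists>m < b e. Q m e)"
  using dec_not[OF dec_all_less[OF dec_not[OF assms(1)] assms(2)]] by simp

section \<open>Closure properties of Sigma_1 relations\<close>

definition sigma1 :: "(nat \<Rightarrow> bool) \<Rightarrow> bool" where
  "sigma1 P \<longleftrightarrow> (\<exists>D. dec D \<and> (\<forall>e. P e \<longleftrightarrow> (\<exists>w. D (prod_encode (w, e)))))"

lemma sigma1I:
  assumes "dec (\<lambda>e. D (pfst e) (psnd e))" "\<And>e. P e \<longleftrightarrow> (\<exists>w. D w e)"
  shows "sigma1 P"
  unfolding sigma1_def using assms by (intro exI[of _ "\<lambda>e. D (pfst e) (psnd e)"]) simp

lemma sigma1E: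
  assumes "sigma1 P"
  obtains D where "dec (\<lambda>e. D (pfst e) (psnd e))" "\<And>e. P e \<longleftrightarrow> (\<exists>w. D w e)"
proof -
  obtain D where D: "dec D" "\<And>e. P e \<longleftrightarrow> (\<exists>w. D (prod_encode (w, e)))"
    using assms unfolding sigma1_def by blast
  show ?thesis by (rule that[of "\<lambda>w e. D (prod_encode (w, e))"]) (use D in simp_all)
qed

lemma sigma1_dec: "dec P \<Longrightarrow> sigma1 P"
  by (rule sigma1I[where D="\<lambda>w e. P e"]) (simp_all add: dec_subst[OF _ comp_psnd[OF comp_id]])

lemma sigma1_subst:
  assumes "sigma1 P" "computable f"
  shows "sigma1 (\<lambda>e. P (f e))"
proof -
  obtain D where D: "dec (\<lambda>e. D (pfst e) (psnd e))" "\<And>e. P e \<longleftrightarrow> (\<exists>w. D w e)"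
    using sigma1E[OF assms(1)] by blast
  have "dec (\<lambda>e. (\<lambda>e. D (pfst e) (psnd e)) (prod_encode (pfst e, f (psnd e))))"
    by (intro dec_subst[OF D(1)] comp_pair comp_pfst comp_subst[OF assms(2)] comp_psnd comp_id)
  thus ?thesis using D(2) by (intro sigma1I[where D="\<lambda>w e. D w (f e)"]) simp_all
qed

lemma sigma1_ex:
  assumes "sigma1 (\<lambda>e. Q (pfst e) (psnd e))"
  shows "sigma1 (\<lambda>e. \<exists>m. Q m e)"
proof -
  obtain D where D: "dec (\<lambda>e. D (pfst e) (psnd e))" "\<And>e. Q (pfst e) (psnd e) \<longleftrightarrow> (\<exists>w. D w e)"
    using sigma1E[OF assms(1)] by blast
  have "dec (\<lambda>e. (\<lambda>e. D (pfst e) (psnd e))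
                  (prod_encode (pfst (pfst e), prod_encode (psnd (pfst e), psnd e))))"
    by (intro dec_subst[OF D(1)] comp_pair comp_pfst comp_psnd comp_id)
  moreover have "(\<exists>m. Q m e) \<longleftrightarrow> (\<exists>w. D (pfst w) (prod_encode (psnd w, e)))" for e
    using D(2)[of "prod_encode (_, e)"] by simp (metis pfst_pair psnd_pair)
  ultimately show ?thesis
    by (intro sigma1I[where D="\<lambda>w e. D (pfst w) (prod_encode (psnd w, e))"]) simp_all
qed

lemma sigma1_conj:
  assumes "sigma1 P" "sigma1 Q"
  shows "sigma1 (\<lambda>e. P e \<and> Q e)"
proof -
  obtain D where D: "dec (\<lambda>e. D (pfst e) (psnd e))" "\<And>e. P e \<longleftrightarrow> (\<exists>w. D w e)"
    using sigma1E[OF assms(1)] by blast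
  obtain E where E: "dec (\<lambda>e. E (pfst e) (psnd e))" "\<And>e. Q e \<longleftrightarrow> (\<exists>w. E w e)"
    using sigma1E[OF assms(2)] by blast
  have "dec (\<lambda>e. (\<lambda>e. D (pfst e) (psnd e)) (prod_encode (pfst (pfst e), psnd e)) \<and>
                 (\<lambda>e. E (pfst e) (psnd e)) (prod_encode (psnd (pfst e), psnd e)))"
    by (intro dec_conj dec_subst[OF D(1)] dec_subst[OF E(1)] comp_pair comp_pfst comp_psnd comp_id)
  moreover have "P e \<and> Q e \<longleftrightarrow> (\<exists>w. D (pfst w) e \<and> E (psnd w) e)" for e
    using D(2) E(2) by (metis pfst_pair psnd_pair)
  ultimately show ?thesis
    by (intro sigma1I[where D="\<lambda>w e. D (pfst w) e \<and> E (psnd w) e"]) simp_all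
qed

lemma sigma1_disj:
  assumes "sigma1 P" "sigma1 Q"
  shows "sigma1 (\<lambda>e. P e \<or> Q e)"
proof -
  obtain D where D: "dec (\<lambda>e. D (pfst e) (psnd e))" "\<And>e. P e \<longleftrightarrow> (\<exists>w. D w e)"
    using sigma1E[OF assms(1)] by blast
  obtain E where E: "dec (\<lambda>e. E (pfst e) (psnd e))" "\<And>e. Q e \<longleftrightarrow> (\<exists>w. E w e)"
    using sigma1E[OF assms(2)] by blast
  show ?thesis
    by (intro sigma1I[where D="\<lambda>w e. D w e \<or> E w e"] dec_disj D E) (auto simp: D E)
qed

text \<open>Collection: finitely many witnesses have a common strict bound \<open>c\<close>, here
  their sum plus one. The unbounded quantifier thus moves in front, leaving bounded quantifiers over
  a decidable matrix.\<close>

lemma sigma1_all_less: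
  assumes Q: "sigma1 (\<lambda>e. Q (pfst e) (psnd e))" and b: "computable b"
  shows "sigma1 (\<lambda>e. \<forall>m < b e. Q m e)"
proof -
  obtain D where D: "dec (\<lambda>e. D (pfst e) (psnd e))" "\<And>e. Q (pfst e) (psnd e) \<longleftrightarrow> (\<exists>w. D w e)"
    using sigma1E[OF Q] by blast
  have Q': "Q m e \<longleftrightarrow> (\<exists>w. D w (prod_encode (m, e)))" for m e
    using D(2)[of "prod_encode (m, e)"] by simp
  have "dec (\<lambda>e. \<forall>m < b (psnd e). \<exists>w < pfst e. (\<lambda>e. D (pfst e) (psnd e))
                   (prod_encode (w, prod_encode (m, psnd e))))"
    by (intro dec_all_less dec_ex_less dec_subst[OF D(1)] comp_subst[OF b]
          comp_pair comp_pfst comp_psnd comp_id)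
  moreover have "(\<forall>m < b e. Q m e) \<longleftrightarrow> (\<exists>c. \<forall>m < b e. \<exists>w < c. D w (prod_encode (m, e)))" for e
  proof
    assume "\<forall>m < b e. Q m e"
    hence "\<forall>m. \<exists>w. m < b e \<longrightarrow> D w (prod_encode (m, e))" using Q' by blast
    then obtain w where w: "\<And>m. m < b e \<Longrightarrow> D (w m) (prod_encode (m, e))" by metis
    have "w m < Suc (\<Sum>m<b e. w m)" if "m < b e" for m
      using member_le_sum[of m "{..<b e}" w] that by (simp add: less_Suc_eq_le)
    thus "\<exists>c. \<forall>m < b e. \<exists>w < c. D w (prod_encode (m, e))" using w by blast
  qed (use Q' in blast)
  ultimately show ?thesis
    by (intro sigma1I[where D="\<lambda>c e. \<forall>m < b e. \<exists>w < c. D w (prod_encode (m, e))"]) simp_all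
qed

section \<open>Evaluation of program codes\<close>

text \<open>Unlike \<^const>\<open>eval\<close>, evaluation of codes also makes sense for numbers that are not
  the code of a program, and it is still single-valued there.\<close>
inductive ceval :: "nat \<Rightarrow> nat list \<Rightarrow> nat \<Rightarrow> bool" where
  ceval_zero: "ceval (list_encode [0]) xs 0"
| ceval_succ: "ceval (list_encode [1]) (x # xs) (Suc x)"
| ceval_proj: "i < length xs \<Longrightarrow> ceval (list_encode [2, i]) xs (xs ! i)"
| ceval_comp: "list_all2 (\<lambda>g y. ceval g xs y) gs ys \<Longrightarrow> ceval f ys z \<Longrightarrow>
    ceval (list_encode (3 # f # gs)) xs z"
| ceval_prim0: "ceval f xs z \<Longrightarrow> ceval (list_encode [4, f, g]) (0 # xs) z"
| ceval_primS: "ceval (list_encode [4, f, g]) (n # xs) y \<Longrightarrow> ceval g (y # n # xs) z \<Longrightarrow>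
    ceval (list_encode [4, f, g]) (Suc n # xs) z"
| ceval_mu: "ceval f (n # xs) 0 \<Longrightarrow> \<forall>m<n. \<exists>k. ceval f (m # xs) (Suc k) \<Longrightarrow>
    ceval (list_encode [5, f]) xs n"

declare list_encode_eq [simp]
declare list_encode.simps [simp del]

lemma ceval_det: "ceval c xs y \<Longrightarrow> ceval c xs z \<Longrightarrow> y = z"
proof (induction c xs y arbitrary: z rule: ceval.induct)
  case (ceval_zero xs)
  from ceval_zero.prems show ?case by (cases rule: ceval.cases) auto
next
  case (ceval_succ x xs)
  from ceval_succ.prems show ?case by (cases rule: ceval.cases) auto
next
  case (ceval_proj i xs)
  from ceval_proj.prems show ?case by (cases rule: ceval.cases) auto
next
  case (ceval_comp xs gs ys f v)
  from ceval_comp.prems obtain ys' where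
    ys': "list_all2 (\<lambda>g y. ceval g xs y) gs ys'" "ceval f ys' z"
    by (cases rule: ceval.cases) auto
  have "ys = ys'" using ceval_comp.IH(1) ys'(1)
    by (auto simp: list_all2_conv_all_nth intro!: nth_equalityI)
  thus ?case using ceval_comp.IH(2) ys'(2) by blast
next
  case (ceval_prim0 f xs v g)
  from ceval_prim0.prems show ?case
    by (cases rule: ceval.cases) (auto intro: ceval_prim0.IH)
next
  case (ceval_primS f g n xs y v)
  from ceval_primS.prems show ?case
    by (cases rule: ceval.cases) (auto dest: ceval_primS.IH)
next
  case (ceval_mu f n xs)
  from ceval_mu.prems have z: "ceval f (z # xs) 0" "\<forall>m<z. \<exists>k. ceval f (m # xs) (Suc k)"
    by (cases rule: ceval.cases; auto)+
  \<comment> \<open>If the two results differed, then at the smaller one the body would evaluate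
    both to 0 and to a successor.\<close>
  have "\<not> z < n" using ceval_mu.IH(2) z(1) by fastforce
  moreover have "\<not> n < z" using ceval_mu.IH(1) z(2) by fastforce
  ultimately show ?case by simp
qed

lemma eval_imp_ceval: "eval r xs y \<Longrightarrow> ceval (code r) xs y"
proof (induction rule: eval.induct)
  case (ev_comp xs gs ys f z)
  have "list_all2 (\<lambda>g y. ceval g xs y) (map code gs) ys"
    using ev_comp.IH(1) by (auto simp: list_all2_conv_all_nth)
  thus ?case using ev_comp.IH(2) by (auto intro: ceval.ceval_comp)
next
  case (ev_mu f n xs)
  thus ?case by (auto intro!: ceval.ceval_mu)
qed (auto intro: ceval.intros simp flip: One_nat_def)

lemma ceval_imp_eval: "ceval c xs y \<Longrightarrow> c = code r \<Longrightarrow> eval r xs y"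
proof (induction c xs y arbitrary: r rule: ceval.induct)
  case (ceval_comp xs gs ys f z)
  obtain f' gs' where r: "r = Cn f' gs'" "f = code f'" "gs = map code gs'"
    using ceval_comp.prems by (cases r) auto
  have "list_all2 (\<lambda>g y. eval g xs y) gs' ys"
    using ceval_comp.IH(1) r(3) by (auto simp: list_all2_conv_all_nth)
  thus ?case using ceval_comp.IH(2) r by (auto intro: ev_comp)
next
  case (ceval_mu f n xs)
  then obtain f' where "r = Mn f'" "f = code f'" by (cases r) auto
  with ceval_mu show ?case by (auto intro!: ev_mu) blast
next
  case (ceval_primS f g n xs y z)
  obtain f' g' where r: "r = Pm f' g'" "f = code f'" "g = code g'"
    using ceval_primS.prems by (cases r) auto
  thus ?case using ceval_primS.IH(1)[of r] ceval_primS.IH(2)[of g'] by (auto intro: ev_primS)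
next
  case (ceval_prim0 f xs z g)
  thus ?case by (cases r) (auto intro: ev_prim0)
next
  case (ceval_zero xs) thus ?case by (cases r) (auto intro: eval.intros)
next
  case (ceval_succ x xs) thus ?case by (cases r) (auto intro: eval.intros)
next
  case (ceval_proj i xs) thus ?case by (cases r) (auto intro: eval.intros)
qed

lemma eval_iff_ceval: "eval r xs y \<longleftrightarrow> ceval (code r) xs y"
  using eval_imp_ceval ceval_imp_eval by blast

lemma eval_det: "eval r xs y \<Longrightarrow> eval r xs z \<Longrightarrow> y = z"
  using ceval_det eval_imp_ceval by blast

text \<open>Puts Sigma_1 relations into the halting form demanded by \<open>mlof_test\<close>. If
  the search halts at \<open>y\<close>, its body has value 0 there, and determinism of evaluation
  turns this into \<open>D y e\<close>.\<close>

lemma sigma1_domain: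
  assumes "sigma1 P"
  shows "\<exists>r. \<forall>e. P e \<longleftrightarrow> (\<exists>y. eval r [e] y)"
proof -
  obtain D where D: "dec (\<lambda>e. D (pfst e) (psnd e))" "\<And>e. P e \<longleftrightarrow> (\<exists>w. D w e)"
    using sigma1E[OF assms(1)] by blast
  obtain r where r: "\<And>e. \<exists>m. D m e \<Longrightarrow> eval (Mn r) [e] (LEAST m. D m e)"
    "\<And>e n. eval r [n, e] (if D n e then 0 else Suc 0)"
    using eval_Mn_dec[OF D(1)] by metis
  have "P e \<longleftrightarrow> (\<exists>y. eval (Mn r) [e] y)" for e
  proof
    assume "\<exists>y. eval (Mn r) [e] y"
    then obtain y where "eval (Mn r) [e] y" ..
    hence "eval r [y, e] 0" by cases auto
    from eval_det[OF r(2)[of y e] this] have "D y e" by (simp split: if_splits)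
    thus "P e" using D(2) by blast
  qed (use r(1) D(2) in blast)
  thus ?thesis by blast
qed

section \<open>Lists as numbers, with computable access\<close>

definition consc :: "nat \<Rightarrow> nat \<Rightarrow> nat" where "consc x c = Suc (prod_encode (x, c))"
definition dropc :: "nat \<Rightarrow> nat \<Rightarrow> nat" where "dropc k c = rec_nat c (\<lambda>_ y. psnd (y - 1)) k"
definition nthc :: "nat \<Rightarrow> nat \<Rightarrow> nat" where "nthc c k = pfst (dropc k c - 1)"
definition lenc :: "nat \<Rightarrow> nat" where "lenc c = (LEAST k. dropc k c = 0)"

lemma list_encode_Nil: "list_encode [] = 0"
  and list_encode_Cons: "list_encode (x # xs) = consc x (list_encode xs)"
  by (simp_all add: list_encode.simps consc_def)

lemma list_encode_eq_0 [simp]: "list_encode xs = 0 \<longleftrightarrow> xs = []"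
  by (cases xs) (auto simp: list_encode_Nil list_encode_Cons consc_def)

lemma dropc_list_encode [simp]: "dropc k (list_encode xs) = list_encode (drop k xs)"
proof (induction k)
  case (Suc k)
  \<comment> \<open>The code 0 of the empty list is its own tail, so dropping too many elements
    stays at 0.\<close>
  have "prod_encode (0, 0) = 0" by (simp add: prod_encode_def)
  hence "psnd 0 = 0" by (metis psnd_pair)
  hence "psnd (list_encode ys - 1) = list_encode (tl ys)" for ys
    by (cases ys) (simp_all add: list_encode_Nil list_encode_Cons consc_def)
  thus ?case using Suc by (simp add: dropc_def drop_Suc tl_drop)
qed (simp add: dropc_def)

lemma nthc_list_encode [simp]: "k < length xs \<Longrightarrow> nthc (list_encode xs) k = xs ! k"
  by (simp add: nthc_def list_encode_Cons consc_def flip: Cons_nth_drop_Suc)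

lemma lenc_list_encode [simp]: "lenc (list_encode xs) = length xs"
  unfolding lenc_def by (rule Least_equality) auto

lemma list_code_cases: obtains xs where "c = list_encode xs"
  by (metis list_decode_inverse)

lemma consc_list_encode [simp]: "consc x (list_encode xs) = list_encode (x # xs)"
  by (simp add: list_encode_Cons)

lemma consc_inj [simp]: "consc x c = consc y d \<longleftrightarrow> x = y \<and> c = d"
  by (simp add: consc_def prod_encode_eq)

lemmas comp_basic = comp_id comp_const comp_Suc comp_add comp_mult comp_diff comp_pair comp_pfst comp_psnd

lemma comp_consc: "computable f \<Longrightarrow> computable g \<Longrightarrow> computable (\<lambda>e. consc (f e) (g e))"
  unfolding consc_def by (intro comp_basic)

lemma comp_dropc: "computable f \<Longrightarrow> computable g \<Longrightarrow> computable (\<lambda>e. dropc (f e) (g e))"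
  unfolding dropc_def by (intro comp_rec comp_basic)

lemma comp_nthc: "computable f \<Longrightarrow> computable g \<Longrightarrow> computable (\<lambda>e. nthc (f e) (g e))"
  unfolding nthc_def by (intro comp_dropc comp_basic)

lemma comp_lenc: assumes "computable f" shows "computable (\<lambda>e. lenc (f e))"
proof (rule comp_subst[OF _ assms])
  have "\<exists>k. dropc k c = 0" for c by (rule list_code_cases[of c]) auto
  thus "computable lenc" unfolding lenc_def by (intro comp_Least dec_eq comp_dropc comp_basic)
qed

lemmas comp_intros = comp_basic comp_consc comp_dropc comp_nthc comp_lenc
lemmas sigma1_intros = sigma1_ex sigma1_all_less sigma1_conj sigma1_disj
  sigma1_dec[OF dec_eq] sigma1_dec[OF dec_le] sigma1_dec[OF dec_less]

section \<open>Finite derivations witnessing evaluation\<close>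

definition judgement :: "nat \<Rightarrow> nat \<Rightarrow> nat \<Rightarrow> nat" where
  "judgement c a y = prod_encode (c, prod_encode (a, y))"

lemma judgement_inj [simp]: "judgement c a y = judgement c' a' y' \<longleftrightarrow> c = c' \<and> a = a' \<and> y = y'"
  by (simp add: judgement_def prod_encode_eq)

lemma judgement_cases: obtains c xs y where "j = judgement c (list_encode xs) y"
  unfolding judgement_def by (metis pair_collapse list_decode_inverse)

text \<open>The rules of \<open>ceval\<close> on list codes, with premises looked up in
  \<open>H\<close>. Quantifiers are existential or bounded universal, which keeps the relation
  Sigma_1; \<open>H\<close> occurs only positively, which makes it monotone in
  \<open>H\<close>.\<close>

definition ceval_step :: "(nat \<Rightarrow> bool) \<Rightarrow> nat \<Rightarrow> nat \<Rightarrow> nat \<Rightarrow> bool" where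
  "ceval_step H c a y \<longleftrightarrow>
     c = consc 0 0 \<and> y = 0 \<or>
     c = consc 1 0 \<and> 0 < lenc a \<and> y = Suc (nthc a 0) \<or>
     (\<exists>i. c = consc 2 (consc i 0) \<and> i < lenc a \<and> y = nthc a i) \<or>
     (\<exists>f gs ys. c = consc 3 (consc f gs) \<and> H (judgement f ys y) \<and> lenc gs = lenc ys \<and>
        (\<forall>k < lenc gs. H (judgement (nthc gs k) a (nthc ys k)))) \<or>
     (\<exists>f g b. c = consc 4 (consc f (consc g 0)) \<and> a = consc 0 b \<and> H (judgement f b y)) \<or>
     (\<exists>f g n b z. c = consc 4 (consc f (consc g 0)) \<and> a = consc (Suc n) b \<and>
        H (judgement c (consc n b) z) \<and> H (judgement g (consc z (consc n b)) y)) \<or>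
     (\<exists>f. c = consc 5 (consc f 0) \<and> H (judgement f (consc y a) 0) \<and>
        (\<forall>m < y. \<exists>k. H (judgement f (consc m a) (Suc k))))"

lemma ceval_step_mono: "(\<And>j. H j \<Longrightarrow> H' j) \<Longrightarrow> ceval_step H c a y \<Longrightarrow> ceval_step H' c a y"
  unfolding ceval_step_def by (elim disj_forward ex_forward conj_forward all_forward imp_forward) blast+

lemma ceval_step_sound:
  assumes H: "\<And>c xs y. H (judgement c (list_encode xs) y) \<Longrightarrow> ceval c xs y"
    and step: "ceval_step H c (list_encode xs) y"
  shows "ceval c xs y"
proof -
  have code0: "consc x 0 = list_encode [x]" for x by (simp add: list_encode_Nil list_encode_Cons)
  show ?thesis using step unfolding ceval_step_def code0
  proof (elim disjE exE conjE)
    assume "c = list_encode [0]" "y = 0"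
    thus ?thesis by (auto intro: ceval.intros)
  next
    assume "c = list_encode [1]" "0 < lenc (list_encode xs)" "y = Suc (nthc (list_encode xs) 0)"
    thus ?thesis by (cases xs) (auto intro: ceval_succ simp flip: One_nat_def)
  next
    fix i assume "c = consc 2 (list_encode [i])" "i < lenc (list_encode xs)" "y = nthc (list_encode xs) i"
    thus ?thesis by (auto intro: ceval_proj)
  next
    fix f gs ys
    assume A: "c = consc 3 (consc f gs)" "H (judgement f ys y)" "lenc gs = lenc ys"
      "\<forall>k < lenc gs. H (judgement (nthc gs k) (list_encode xs) (nthc ys k))"
    obtain gl yl where l: "gs = list_encode gl" "ys = list_encode yl" using list_code_cases by metis
    show ?thesis using A unfolding l
      by (simp, intro ceval_comp[of _ _ yl]) (auto intro: H simp: list_all2_conv_all_nth)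
  next
    fix f g b assume A: "c = consc 4 (consc f (list_encode [g]))" "list_encode xs = consc 0 b" "H (judgement f b y)"
    obtain bl where l: "b = list_encode bl" using list_code_cases by metis
    show ?thesis using A unfolding l by (auto intro: ceval_prim0 H)
  next
    fix f g n b z assume A: "c = consc 4 (consc f (list_encode [g]))" "list_encode xs = consc (Suc n) b"
       "H (judgement c (consc n b) z)" "H (judgement g (consc z (consc n b)) y)"
    obtain bl where l: "b = list_encode bl" using list_code_cases by metis
    show ?thesis using A unfolding l by (auto intro: ceval_primS H)
  next
    fix f assume A: "c = consc 5 (list_encode [f])" "H (judgement f (consc y (list_encode xs)) 0)"
        "\<forall>m < y. \<exists>k. H (judgement f (consc m (list_encode xs)) (Suc k))"
    have "\<forall>m < y. \<exists>k. ceval f (m # xs) (Suc k)" using A(3) H by (metis consc_list_encode)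
    thus ?thesis using A by (simp, intro ceval_mu) (auto intro: H)
  qed
qed

text \<open>A derivation lists judgements so that each follows from later entries by one rule.\<close>
definition derivation :: "nat \<Rightarrow> bool" where
  "derivation h \<longleftrightarrow> (\<forall>k < lenc h. ceval_step (\<lambda>j. \<exists>l < lenc (dropc (Suc k) h). nthc (dropc (Suc k) h) l = j)
     (pfst (nthc h k)) (pfst (psnd (nthc h k))) (psnd (psnd (nthc h k))))"

lemma derivation_Nil [simp]: "derivation (list_encode [])"
  by (simp add: derivation_def del: list_encode_eq_0)

lemma derivation_Cons [simp]:
  "derivation (list_encode (judgement c a y # hs)) \<longleftrightarrow>
     ceval_step (\<lambda>j. j \<in> set hs) c a y \<and> derivation (list_encode hs)"
proof -
  have *: "(\<lambda>j. \<exists>l < lenc (list_encode ks). nthc (list_encode ks) l = j) = (\<lambda>j. j \<in> set ks)" for ks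
    by (auto simp: in_set_conv_nth intro!: ext cong: conj_cong)
  have "derivation (list_encode ks) \<longleftrightarrow> (\<forall>k < length ks. ceval_step (\<lambda>j. j \<in> set (drop (Suc k) ks))
     (pfst (ks ! k)) (pfst (psnd (ks ! k))) (psnd (psnd (ks ! k))))" for ks
    unfolding derivation_def dropc_list_encode * by simp
  thus ?thesis by (simp add: All_less_Suc2 judgement_def)
qed

text \<open>Entries refer only to entries further right, so appending on the right merely enlarges
  the set of available premises.\<close>

lemma derivation_append:
  "derivation (list_encode hs) \<Longrightarrow> derivation (list_encode ks) \<Longrightarrow> derivation (list_encode (hs @ ks))"
proof (induction hs)
  case (Cons j hs)
  obtain c a y where j: "j = judgement c a y" by (rule judgement_cases)
  show ?case using Cons unfolding j by (auto elim!: ceval_step_mono[rotated])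
qed simp

lemma derivation_sound:
  "derivation (list_encode hs) \<Longrightarrow> judgement c (list_encode xs) y \<in> set hs \<Longrightarrow> ceval c xs y"
proof (induction hs arbitrary: c xs y)
  case (Cons j hs)
  obtain c' xs' y' where j: "j = judgement c' (list_encode xs') y'" by (rule judgement_cases)
  have "ceval c' xs' y'"
    by (rule ceval_step_sound[of "\<lambda>j. j \<in> set hs"]) (use Cons j in auto)
  thus ?case using Cons j by auto
qed simp

definition derivable :: "nat \<Rightarrow> bool" where
  "derivable j \<longleftrightarrow> (\<exists>hs. derivation (list_encode hs) \<and> j \<in> set hs)"

text \<open>Composition and minimization have any finite number of premises; concatenation gathers
  their separate derivations into one.\<close>

lemma derivable_finite:
  assumes "finite A" "\<And>j. j \<in> A \<Longrightarrow> derivable j"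
  shows "\<exists>hs. derivation (list_encode hs) \<and> A \<subseteq> set hs"
  using assms
proof (induction A rule: finite_induct)
  case (insert j A)
  then obtain hs ks where "derivation (list_encode hs)" "j \<in> set hs" "derivation (list_encode ks)" "A \<subseteq> set ks"
    unfolding derivable_def by blast
  thus ?case by (intro exI[of _ "hs @ ks"]) (auto intro: derivation_append)
qed (auto intro: exI[of _ "[]"])

lemma derivable_step:
  assumes "finite A" "\<And>j. j \<in> A \<Longrightarrow> derivable j" "ceval_step (\<lambda>j. j \<in> A) c a y"
  shows "derivable (judgement c a y)"
proof -
  obtain hs where "derivation (list_encode hs)" "A \<subseteq> set hs" using derivable_finite[OF assms(1,2)] by blast
  hence "derivation (list_encode (judgement c a y # hs))"
    using assms(3) by (auto elim!: ceval_step_mono[rotated])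
  thus ?thesis unfolding derivable_def by (intro exI[of _ "judgement c a y # hs"]) simp
qed

lemma derivation_complete: "ceval c xs y \<Longrightarrow> derivable (judgement c (list_encode xs) y)"
proof (induction rule: ceval.induct)
  case (ceval_zero xs)
  show ?case by (rule derivable_step[of "{}"]) (auto simp: ceval_step_def list_encode_Cons list_encode_Nil)
next
  case (ceval_succ x xs)
  show ?case
    by (rule derivable_step[of "{}"])
       (auto simp: ceval_step_def list_encode_Cons[of _ "[]"] list_encode_Nil)
next
  case (ceval_proj i xs)
  thus ?case
    by (intro derivable_step[of "{}"]) (auto simp: ceval_step_def list_encode_Cons list_encode_Nil simp del: consc_list_encode)
next
  case (ceval_comp xs gs ys f z)
  let ?A = "insert (judgement f (list_encode ys) z)
    ((\<lambda>k. judgement (gs ! k) (list_encode xs) (ys ! k)) ` {..<length gs})"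
  have len: "length gs = length ys" using ceval_comp.IH(1) by (rule list_all2_lengthD)
  show ?case
  proof (rule derivable_step[of ?A])
    show "derivable j" if "j \<in> ?A" for j
      using that ceval_comp.IH by (auto simp: list_all2_conv_all_nth)
    have "list_encode (3 # f # gs) = consc 3 (consc f (list_encode gs)) \<and>
       judgement f (list_encode ys) z \<in> ?A \<and> lenc (list_encode gs) = lenc (list_encode ys) \<and>
       (\<forall>k < lenc (list_encode gs). judgement (nthc (list_encode gs) k) (list_encode xs) (nthc (list_encode ys) k) \<in> ?A)"
      using len by auto
    thus "ceval_step (\<lambda>j. j \<in> ?A) (list_encode (3 # f # gs)) (list_encode xs) z"
      unfolding ceval_step_def by blast
  qed simp
next
  case (ceval_prim0 f xs z g)
  show ?case
    by (rule derivable_step[of "{judgement f (list_encode xs) z}"])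
       (use ceval_prim0 in \<open>auto simp: ceval_step_def list_encode_Cons list_encode_Nil simp del: consc_list_encode\<close>)
next
  case (ceval_primS f g n xs y z)
  show ?case
    by (rule derivable_step[of "{judgement (list_encode [4, f, g]) (list_encode (n # xs)) y,
          judgement g (list_encode (y # n # xs)) z}"])
       (use ceval_primS in \<open>auto simp: ceval_step_def list_encode_Cons list_encode_Nil simp del: consc_list_encode\<close>)
next
  case (ceval_mu f n xs)
  obtain k where k: "\<And>m. m < n \<Longrightarrow> derivable (judgement f (list_encode (m # xs)) (Suc (k m)))"
    using ceval_mu.IH(2) by metis
  show ?case
    by (rule derivable_step[of "insert (judgement f (list_encode (n # xs)) 0)
          ((\<lambda>m. judgement f (list_encode (m # xs)) (Suc (k m))) ` {..<n})"])
       (use ceval_mu k in \<open>auto simp: ceval_step_def list_encode_Cons list_encode_Nil simp del: consc_list_encode\<close>)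
qed

text \<open>The universal program, in the manner of Kleene's normal form: even the program code may
  depend on the environment, and evaluation amounts to the existence of a coded derivation.\<close>

lemma sigma1_ceval:
  assumes "computable f" "computable g" "computable h"
  shows "sigma1 (\<lambda>e. ceval (f e) [g e] (h e))"
proof -
  have eq: "ceval c [x] y \<longleftrightarrow>
    (\<exists>h. (\<exists>k < lenc h. nthc h k = judgement c (consc x 0) y) \<and> derivation h)" for c x y
  proof
    assume "ceval c [x] y"
    then obtain hs where "derivation (list_encode hs)" "judgement c (list_encode [x]) y \<in> set hs"
      using derivation_complete unfolding derivable_def by blast
    thus "\<exists>h. (\<exists>k < lenc h. nthc h k = judgement c (consc x 0) y) \<and> derivation h"
      by (intro exI[of _ "list_encode hs"]) (auto simp: in_set_conv_nth list_encode_Cons list_encode_Nil)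
  next
    assume "\<exists>h. (\<exists>k < lenc h. nthc h k = judgement c (consc x 0) y) \<and> derivation h"
    then obtain hs k where "k < length hs" "hs ! k = judgement c (consc x 0) y" "derivation (list_encode hs)"
      by (metis list_decode_inverse lenc_list_encode nthc_list_encode)
    thus "ceval c [x] y"
      by (intro derivation_sound) (auto simp: in_set_conv_nth list_encode_Cons list_encode_Nil)
  qed
  show ?thesis unfolding eq derivation_def ceval_step_def judgement_def
    by (intro sigma1_intros comp_intros assms[THEN comp_subst])
qed

section \<open>Lower semicomputable sums\<close>

text \<open>Arithmetic on the codes of \<open>rat_of_code\<close>, by cross multiplication of
  unreduced fractions. A code stores the denominator minus one, hence every \<open>Suc\<close> and
  \<open>- 1\<close> below.\<close>

definition rle :: "nat \<Rightarrow> nat \<Rightarrow> bool" where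
  "rle m n \<longleftrightarrow> pfst m * Suc (psnd n) \<le> pfst n * Suc (psnd m)"
definition radd :: "nat \<Rightarrow> nat \<Rightarrow> nat" where
  "radd m n = prod_encode (pfst m * Suc (psnd n) + pfst n * Suc (psnd m), Suc (psnd m) * Suc (psnd n) - 1)"
definition rmul :: "nat \<Rightarrow> nat \<Rightarrow> nat" where
  "rmul m n = prod_encode (pfst m * pfst n, Suc (psnd m) * Suc (psnd n) - 1)"
text \<open>The value 0 at zero agrees with the convention \<open>inverse 0 = 0\<close>, so
  \<open>rv_rinv\<close> holds for every code and division on codes matches real division.\<close>

definition rinv :: "nat \<Rightarrow> nat" where
  "rinv n = (if pfst n = 0 then 0 else prod_encode (Suc (psnd n), pfst n - 1))"
definition rnat :: "nat \<Rightarrow> nat" where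
  "rnat n = prod_encode (n, 0)"

abbreviation rv :: "nat \<Rightarrow> real" where "rv n \<equiv> real_of_rat (rat_of_code n)"

lemma rv_eq: "rv n = real (pfst n) / real (Suc (psnd n))"
  by (simp add: rat_of_code_def pfst_def psnd_def split_beta of_rat_divide of_rat_add)

lemma rv_nonneg [simp]: "0 \<le> rv n"
  by (simp add: rv_eq)

lemma rv_0 [simp]: "rv 0 = 0"
  using pfst_pair[of 0 0] by (simp add: rv_eq prod_encode_def)

lemma rle_iff: "rle m n \<longleftrightarrow> rv m \<le> rv n"
proof -
  have "rle m n \<longleftrightarrow> real (pfst m * Suc (psnd n)) \<le> real (pfst n * Suc (psnd m))"
    unfolding rle_def of_nat_le_iff ..
  also have "\<dots> \<longleftrightarrow> rv m \<le> rv n"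
    unfolding rv_eq of_nat_mult by (simp add: pos_le_divide_eq pos_divide_le_eq del: of_nat_Suc)
  finally show ?thesis .
qed

lemma real_Suc_mult_diff: "real (Suc (Suc a * Suc b - 1)) = real (Suc a) * real (Suc b)"
  by (simp add: algebra_simps)

lemma rv_radd [simp]: "rv (radd m n) = rv m + rv n"
  unfolding rv_eq radd_def pfst_pair psnd_pair real_Suc_mult_diff by (simp add: field_simps)

lemma rv_rmul [simp]: "rv (rmul m n) = rv m * rv n"
  unfolding rv_eq rmul_def pfst_pair psnd_pair real_Suc_mult_diff by simp

lemma rv_rinv [simp]: "rv (rinv n) = inverse (rv n)"
proof (cases "pfst n = 0")
  case False
  thus ?thesis by (simp add: rv_eq rinv_def)
qed (simp add: rinv_def rv_eq[of n])

lemma rv_rnat [simp]: "rv (rnat n) = real n"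
  by (simp add: rv_eq rnat_def)

lemma comp_radd: "computable f \<Longrightarrow> computable g \<Longrightarrow> computable (\<lambda>e. radd (f e) (g e))"
  and comp_rmul: "computable f \<Longrightarrow> computable g \<Longrightarrow> computable (\<lambda>e. rmul (f e) (g e))"
  and comp_rinv: "computable f \<Longrightarrow> computable (\<lambda>e. rinv (f e))"
  and comp_rnat: "computable f \<Longrightarrow> computable (\<lambda>e. rnat (f e))"
  unfolding radd_def rmul_def rinv_def rnat_def by (intro comp_if dec_eq comp_basic; assumption)+

lemma dec_rle: "computable f \<Longrightarrow> computable g \<Longrightarrow> dec (\<lambda>e. rle (f e) (g e))"
  unfolding rle_def by (intro dec_le comp_basic)

lemmas comp_rat = comp_radd comp_rmul comp_rinv comp_rnat

text \<open>\<open>blen\<close> maps the code of a string of length n to \<open>2 ^ n\<close>.\<close>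
definition blen :: "nat \<Rightarrow> nat" where
  "blen m = rec_nat 1 (\<lambda>k y. if k + 2 = 2 * y then 2 * y else y) m"

lemma blen_rec: "blen 0 = 1" "blen (Suc m) = (if m + 2 = 2 * blen m then 2 * blen m else blen m)"
  by (simp_all add: blen_def)

lemma blen_bounds: "(\<exists>k. blen m = 2 ^ k) \<and> blen m \<le> m + 1 \<and> m + 1 < 2 * blen m"
proof (induction m)
  case (Suc m)
  then obtain k where "blen m = 2 ^ k" by blast
  hence "blen (Suc m) = 2 ^ k \<or> blen (Suc m) = 2 ^ Suc k" by (auto simp: blen_rec)
  thus ?case using Suc by (auto simp: blen_rec simp del: power_Suc)
qed (auto simp: blen_rec intro: exI[of _ 0])

lemma benc_bounds: "2 ^ length x \<le> benc x + 1 \<and> benc x + 1 < 2 * 2 ^ length x"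
  by (induction x) auto

text \<open>Both sides are powers of two \<open>y\<close> with
  \<open>y \<le> benc x + 1 < 2 * y\<close>, and there is only one such power.\<close>

lemma blen_benc [simp]: "blen (benc x) = 2 ^ length x"
proof -
  obtain k where k: "blen (benc x) = 2 ^ k" using blen_bounds by blast
  have "(2::nat) ^ k < 2 ^ Suc (length x)" "(2::nat) ^ length x < 2 ^ Suc k"
    using blen_bounds[of "benc x"] benc_bounds[of x] k by auto
  hence "k < Suc (length x)" "length x < Suc k"
    by (metis one_less_numeral_iff power_strict_increasing_iff semiring_norm(76))+
  thus ?thesis using k by simp
qed

lemma comp_blen: "computable f \<Longrightarrow> computable (\<lambda>e. blen (f e))"
  unfolding blen_def by (intro comp_rec comp_if dec_eq comp_basic)

lemma comp_power2: assumes "computable f" shows "computable (\<lambda>e. 2 ^ f e)"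
proof -
  have "computable (\<lambda>e. rec_nat 1 (\<lambda>k y. 2 * y) (f e))" by (intro comp_rec comp_basic assms)
  moreover have "rec_nat 1 (\<lambda>k y. 2 * y) n = (2::nat) ^ n" for n by (induction n) auto
  ultimately show ?thesis by simp
qed

lemma benc_inj [simp]: "benc x = benc y \<longleftrightarrow> x = y"
proof (induction x arbitrary: y)
  case Nil show ?case by (cases y) auto
next
  case (Cons a x)
  show ?case
  proof (cases y)
    case (Cons b z)
    have "benc (a # x) = benc (b # z) \<longleftrightarrow> a = b \<and> benc x = benc z"
      by (cases a; cases b) (simp; presburger)+
    thus ?thesis using Cons.IH Cons by simp
  qed simp
qed

lemma benc_surj: "\<exists>x. benc x = m"
proof (induction m rule: less_induct)
  case (less m)
  show ?case
  proof (cases "m = 0")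
    case False
    obtain x where x: "benc x = (m - 1) div 2" using less[of "(m - 1) div 2"] False by fastforce
    have "benc (even m # x) = m" using False by (auto simp: x)
    thus ?thesis by blast
  qed (auto intro: exI[of _ "[]"])
qed

text \<open>\<open>benc\<close> is base-2 notation with digits 1 and 2, the first symbol being the
  lowest digit; an appended symbol becomes the new top digit.\<close>

lemma benc_snoc: "benc (x @ [b]) = benc x + (if b then 2 else 1) * 2 ^ length x"
  by (induction x) auto

lemma run_iff: "run r p = Some s \<longleftrightarrow> eval r [benc p] (benc s)"
proof -
  have "(THE y. eval r [benc p] (benc y)) = y" if "eval r [benc p] (benc y)" for y
    using eval_det[OF that] by (intro the_equality that) (metis benc_inj)
  thus ?thesis unfolding run_def by (auto; metis)
qed

text \<open>A stage \<open>t\<close> is read as a pair of a witness and a proposed value. A proposal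
  that its witness does not confirm is replaced by 0, which is still a lower bound because
  \<open>S\<close> is nonnegative.\<close>

lemma lower_semicomputableI:
  assumes A: "sigma1 (\<lambda>e. A (pfst e) (psnd e))"
    and le: "\<And>x a. A (benc x) a \<Longrightarrow> rv a \<le> S x"
    and nonneg: "\<And>x. 0 \<le> S x"
    and approx: "\<And>x e. 0 < e \<Longrightarrow> \<exists>a. A (benc x) a \<and> S x - e < rv a"
  shows "lower_semicomputable S"
proof -
  obtain D where D: "dec (\<lambda>e. D (pfst e) (psnd e))" "\<And>e. A (pfst e) (psnd e) \<longleftrightarrow> (\<exists>w. D w e)"
    using sigma1E[OF A] by blast
  define h where "h t x = (if D (pfst t) (prod_encode (x, psnd t)) then psnd t else 0)" for t x
  have "computable (\<lambda>e. if (\<lambda>e. D (pfst e) (psnd e)) (prod_encode (pfst (pfst e), prod_encode (psnd e, psnd (pfst e))))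
           then psnd (pfst e) else 0)"
    by (intro comp_if dec_subst[OF D(1)] comp_basic)
  hence "computable (\<lambda>e. h (pfst e) (psnd e))" by (simp add: h_def)
  then obtain r where r: "\<And>e. eval r [e] (h (pfst e) (psnd e))" unfolding computable_def by blast
  have ev: "eval (Cn r [pair_recf]) [t, m] (h t m)" for t m
    using eval_CnI1[OF eval_pair r, of t m] by simp
  have bound: "rv (h t (benc x)) \<le> S x" for t x
    using D(2)[of "prod_encode (benc x, psnd t)"] le nonneg by (auto simp: h_def)
  have approx': "\<exists>t. S x - e < rv (h t (benc x))" if e: "0 < e" for x e
  proof -
    obtain a where a: "A (benc x) a" "S x - e < rv a" using approx[OF e] by blast
    then obtain w where "D w (prod_encode (benc x, a))"
      using D(2)[of "prod_encode (benc x, a)"] by auto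
    thus ?thesis using a by (intro exI[of _ "prod_encode (w, a)"]) (simp add: h_def)
  qed
  show ?thesis unfolding lower_semicomputable_def
    by (rule exI[of _ "\<lambda>t x. rat_of_code (h t (benc x))"], rule exI[of _ "Cn r [pair_recf]"])
       (use ev bound approx' in blast)
qed

lemma sequence_code: "\<exists>c. \<forall>k \<le> N. nthc c k = f k"
  by (rule exI[of _ "list_encode (map f [0..<Suc N])"]) (auto simp del: upt_Suc)

lemma lower_semicomputable_weighted_sum:
  assumes w: "computable w"
    and G: "sigma1 (\<lambda>e. G (pfst e) (pfst (psnd e)) (psnd (psnd e)))"
    and G_val: "\<And>i x n. G i (benc x) n \<Longrightarrow> v i x = rv n"
    and val_G: "\<And>i x. v i x \<noteq> 0 \<Longrightarrow> \<exists>n. G i (benc x) n"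
    and nonneg: "\<And>i x. 0 \<le> v i x"
    and S: "\<And>x. (\<lambda>i. v i x / real (w i)) sums S x"
  shows "lower_semicomputable S"
proof -
  \<comment> \<open>The sequence \<open>c\<close> is a history of partial sums. Each term may be
    skipped: that a term has no value is not semidecidable, and skipping only lowers the result, so
    every \<open>a\<close> in \<open>A\<close> is a valid lower bound.\<close>
  define A where "A m a \<longleftrightarrow> (\<exists>N c. nthc c 0 = 0 \<and> nthc c N = a \<and>
     (\<forall>k < N. nthc c (Suc k) = nthc c k \<or>
        (\<exists>n. G k m n \<and> nthc c (Suc k) = radd (nthc c k) (rmul n (rinv (rnat (w k)))))))" for m a
  have sG: "sigma1 (\<lambda>e. G (f e) (g e) (h e))" if "computable f" "computable g" "computable h" for f g h
    using sigma1_subst[OF G, of "\<lambda>e. prod_encode (f e, prod_encode (g e, h e))"] that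
    by (simp add: comp_pair)
  have sA: "sigma1 (\<lambda>e. A (pfst e) (psnd e))"
    unfolding A_def by (intro sigma1_intros comp_intros comp_rat sG comp_subst[OF w])
  have nn: "0 \<le> v i x / real (w i)" for i x using nonneg by simp
  show ?thesis
  proof (rule lower_semicomputableI[OF sA])
    show "0 \<le> S x" for x using S nn sums_le[OF _ sums_zero S] by blast
  next
    fix x a assume "A (benc x) a"
    then obtain N c where c: "nthc c 0 = 0" "nthc c N = a" "\<And>k. k < N \<Longrightarrow> nthc c (Suc k) = nthc c k \<or>
        (\<exists>n. G k (benc x) n \<and> nthc c (Suc k) = radd (nthc c k) (rmul n (rinv (rnat (w k)))))"
      unfolding A_def by blast
    have "k \<le> N \<Longrightarrow> rv (nthc c k) \<le> (\<Sum>i<k. v i x / real (w i))" for k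
    proof (induction k)
      case (Suc k)
      have "rv (nthc c (Suc k)) \<le> rv (nthc c k) + v k x / real (w k)"
        using c(3)[of k] Suc.prems nn[of k x] G_val[of k x] by (auto simp: divide_inverse)
      thus ?case using Suc by simp
    qed (simp add: c)
    hence "rv a \<le> (\<Sum>i<N. v i x / real (w i))" using c(2) by blast
    also have "\<dots> \<le> S x" using sum_le_suminf[OF sums_summable[OF S], of "{..<N}" x] nn sums_unique[OF S] by simp
    finally show "rv a \<le> S x" .
  next
    fix x and e :: real assume e: "0 < e"
    have "(\<lambda>N. \<Sum>i<N. v i x / real (w i)) \<longlonglongrightarrow> S x" using S unfolding sums_def .
    from order_tendstoD(1)[OF this, of "S x - e"] e
    obtain N where N: "S x - e < (\<Sum>i<N. v i x / real (w i))" by (auto dest: eventually_happens)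
    \<comment> \<open>The history that skips only terms without a value; by \<open>val_G\<close>
      those are zero, so it attains the true partial sums.\<close>
    define f where "f = rec_nat 0 (\<lambda>k y. if \<exists>n. G k (benc x) n
      then radd y (rmul (SOME n. G k (benc x) n) (rinv (rnat (w k)))) else y)"
    have f: "f 0 = 0" "f (Suc k) = (if \<exists>n. G k (benc x) n
      then radd (f k) (rmul (SOME n. G k (benc x) n) (rinv (rnat (w k)))) else f k)" for k
      unfolding f_def by (rule nat.rec(1), rule nat.rec(2))
    have fv: "rv (f k) = (\<Sum>i<k. v i x / real (w i))" for k
    proof (induction k)
      case (Suc k)
      show ?case
      proof (cases "\<exists>n. G k (benc x) n")
        case True
        have "v k x = rv (SOME n. G k (benc x) n)" by (rule G_val[OF someI_ex[OF True]])
        thus ?thesis using True Suc by (simp add: f divide_inverse)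
      next
        case False
        hence "v k x = 0" using val_G by blast
        thus ?thesis using False Suc by (simp add: f)
      qed
    qed (simp add: f)
    obtain c where c: "\<And>k. k \<le> N \<Longrightarrow> nthc c k = f k" using sequence_code by blast
    have "nthc c (Suc k) = nthc c k \<or>
        (\<exists>n. G k (benc x) n \<and> nthc c (Suc k) = radd (nthc c k) (rmul n (rinv (rnat (w k)))))" if "k < N" for k
      using that someI_ex[of "G k (benc x)"] by (auto simp: c f)
    hence "A (benc x) (f N)" unfolding A_def using c f(1)
      by (intro exI[of _ N] exI[of _ c]) auto
    thus "\<exists>a. A (benc x) a \<and> S x - e < rv a" using N fv by auto
  qed
qed

section \<open>Domination by the universal semimeasure\<close>

text \<open>Induction on the depth of \<open>A\<close> below \<open>w\<close>. Either
  \<open>w\<close> belongs to \<open>A\<close> and is then its only element, or \<open>A\<close>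
  splits into the parts below the two children of \<open>w\<close>.\<close>

lemma semimeasure_antichain:
  assumes S: "semimeasure S" and "finite A"
    and anti: "\<forall>a\<in>A. \<forall>b\<in>A. (\<exists>w. b = a @ w) \<longrightarrow> a = b"
    and ext: "\<forall>a\<in>A. \<exists>v. a = w @ v"
  shows "(\<Sum>a\<in>A. S a) \<le> S w"
proof -
  have nn: "0 \<le> S x" and snoc: "S (x @ [False]) + S (x @ [True]) \<le> S x" for x
    using S unfolding semimeasure_def by auto
  have "\<forall>a\<in>A. length a \<le> length w + n \<Longrightarrow> ?thesis" for n
    using assms(2-)
  proof (induction n arbitrary: w A)
    case 0
    have "a = w" if a: "a \<in> A" for a
    proof -
      obtain v where "a = w @ v" using 0(4) a by blast
      moreover have "length a \<le> length w" using 0(1) a by simp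
      ultimately show ?thesis by simp
    qed
    hence "A = {} \<or> A = {w}" by blast
    thus ?case using nn[of w] by (elim disjE) simp_all
  next
    case (Suc n)
    show ?case
    proof (cases "w \<in> A")
      case True
      have "w = a" if "a \<in> A" for a
        using Suc.prems(3)[rule_format, OF True that] Suc.prems(4)[rule_format, OF that] by simp
      hence "A = {w}" using True by blast
      thus ?thesis by simp
    next
      case False
      let ?B = "\<lambda>b. {a \<in> A. \<exists>v. a = (w @ [b]) @ v}"
      have A: "A = ?B False \<union> ?B True"
      proof -
        have "a \<in> ?B False \<union> ?B True" if a: "a \<in> A" for a
        proof -
          obtain v where v: "a = w @ v" using Suc.prems(4) a by blast
          moreover have "v \<noteq> []" using v a False by auto
          ultimately obtain b u where "a = (w @ [b]) @ u" by (cases v) auto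
          thus ?thesis using a by (cases b) auto
        qed
        thus ?thesis by blast
      qed
      have le: "sum S (?B b) \<le> S (w @ [b])" for b
      proof (rule Suc.IH)
        show "\<forall>a\<in>?B b. \<forall>b\<in>?B b. (\<exists>w. b = a @ w) \<longrightarrow> a = b" using Suc.prems(3) by simp
      qed (use Suc.prems(1,2) in auto)
      have "sum S (?B False) + sum S (?B True) \<le> S w"
        by (rule order_trans[OF add_mono[OF le le] snoc])
      moreover have "sum S A = sum S (?B False) + sum S (?B True)"
        by (subst A, rule sum.union_disjoint) (use Suc.prems(2) in auto)
      ultimately show ?thesis by simp
    qed
  qed
  moreover have "\<forall>a\<in>A. length a \<le> length w + Max (length ` A)"
    using \<open>finite A\<close> by (auto intro: trans_le_add2)
  ultimately show ?thesis by blast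
qed

lemma semimeasure_le_Nil: "semimeasure S \<Longrightarrow> S x \<le> S []"
  using semimeasure_antichain[of S "{x}" "[]"] by simp

text \<open>The weighted sum of the family is itself a lower semicomputable semimeasure and each of
  its terms lies below it. The bound \<open>kraft\<close> at the root carries over to every string
  because a semimeasure is largest at the empty word.\<close>

lemma universal_dominates_family:
  assumes M: "universal_semimeasure M" and w: "computable w"
    and G: "sigma1 (\<lambda>e. G (pfst e) (pfst (psnd e)) (psnd (psnd e)))"
    and G_val: "\<And>i x n. G i (benc x) n \<Longrightarrow> v i x = rv n"
    and val_G: "\<And>i x. v i x \<noteq> 0 \<Longrightarrow> \<exists>n. G i (benc x) n"
    and v: "\<And>i. semimeasure (v i)"
    and kraft: "\<And>N. (\<Sum>i<N. v i [] / real (w i)) \<le> 1"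
  shows "\<exists>c>0. \<forall>i x. c * (v i x / real (w i)) \<le> M x"
proof -
  have nn: "0 \<le> v i x" and snoc: "v i (x @ [False]) + v i (x @ [True]) \<le> v i x" for i x
    using v unfolding semimeasure_def by auto
  have nnw: "0 \<le> v i x / real (w i)" for i x using nn by simp
  have sum_le: "(\<Sum>i<N. v i x / real (w i)) \<le> 1" for N x
    using order_trans[OF sum_mono kraft] semimeasure_le_Nil[OF v] by (simp add: divide_right_mono)
  have summ: "summable (\<lambda>i. v i x / real (w i))" for x
    by (rule summableI_nonneg_bounded[OF nnw sum_le])
  define S where "S x = (\<Sum>i. v i x / real (w i))" for x
  have sums: "(\<lambda>i. v i x / real (w i)) sums S x" for x
    unfolding S_def using summ by (rule summable_sums)
  have "lower_semicomputable S"
    by (rule lower_semicomputable_weighted_sum[OF w G G_val val_G nn sums])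
  moreover have "semimeasure S" unfolding semimeasure_def
  proof (intro conjI allI)
    show "S [] \<le> 1" unfolding S_def by (rule suminf_le_const[OF summ sum_le])
    show "0 \<le> S x" for x unfolding S_def by (rule suminf_nonneg[OF summ nnw])
    show "S (x @ [False]) + S (x @ [True]) \<le> S x" for x
      by (rule sums_le[OF _ sums_add[OF sums sums] sums])
         (use snoc in \<open>auto simp: divide_right_mono simp flip: add_divide_distrib\<close>)
  qed
  ultimately obtain c where c: "0 < c" "\<And>x. c * S x \<le> M x"
    using M unfolding universal_semimeasure_def by blast
  have "c * (v i x / real (w i)) \<le> M x" for i x
  proof -
    have "v i x / real (w i) \<le> S x"
      using sum_le_suminf[OF summ, of "{i}" x] nnw unfolding S_def by simp
    thus ?thesis using c by (meson mult_le_cancel_left_pos order_trans)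
  qed
  thus ?thesis using c(1) by blast
qed

text \<open>The value of the program e at the string with code m is used only after the semimeasure
  inequalities are confirmed at all strings with smaller codes; this forces a semimeasure out of an
  arbitrary program. The children of the string with code k have the codes \<open>k + blen k\<close> and
  \<open>k + 2 * blen k\<close>.\<close>
definition good :: "nat \<Rightarrow> nat \<Rightarrow> bool" where
  "good e m \<longleftrightarrow> (\<exists>a. ceval e [0] a \<and> rle a (rnat 1)) \<and>
     (\<forall>k < m. \<exists>a b c. ceval e [k] a \<and> ceval e [k + 1 * blen k] b \<and> ceval e [k + 2 * blen k] c \<and> rle (radd b c) a)"

definition cval :: "nat \<Rightarrow> bool list \<Rightarrow> real" where
  "cval e x = rv (THE n. ceval e [benc x] n)"

lemma cval_eq: "ceval e [benc x] n \<Longrightarrow> cval e x = rv n"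
  unfolding cval_def using ceval_det by (metis the_equality)

text \<open>This covers divergence too: the description then denotes an unspecified number, but
  every number codes a nonnegative rational.\<close>

lemma cval_nonneg: "0 \<le> cval e x"
  unfolding cval_def by (rule rv_nonneg)

lemma benc_snoc_greater: "benc x < benc (x @ [b])"
  by (simp add: benc_snoc)

lemma good_mono: "good e m \<Longrightarrow> k \<le> m \<Longrightarrow> good e k"
  unfolding good_def by auto

lemma good_Nil: "good e m \<Longrightarrow> cval e [] \<le> 1"
  unfolding good_def using cval_eq[of e "[]"] by (auto simp: rle_iff)

lemma good_snoc: 
  assumes "good e (benc (x @ [b]))"
  shows "cval e (x @ [False]) + cval e (x @ [True]) \<le> cval e x"
    "\<exists>n. ceval e [benc x] n"
proof -
  obtain a b c where abc: "ceval e [benc x] a" "ceval e [benc x + 1 * blen (benc x)] b"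
      "ceval e [benc x + 2 * blen (benc x)] c" "rle (radd b c) a"
    using assms benc_snoc_greater[of x b] unfolding good_def by blast
  hence "cval e (x @ [False]) = rv b" "cval e (x @ [True]) = rv c" "cval e x = rv a"
    by (auto intro!: cval_eq simp: benc_snoc)
  thus "cval e (x @ [False]) + cval e (x @ [True]) \<le> cval e x" using abc(4) by (simp add: rle_iff)
  show "\<exists>n. ceval e [benc x] n" using abc(1) by blast
qed

lemma sigma1_good:
  assumes "computable f" "computable g"
  shows "sigma1 (\<lambda>e. good (f e) (g e))"
  unfolding good_def
  by (intro sigma1_intros sigma1_ceval sigma1_dec[OF dec_rle] comp_intros comp_rat comp_blen assms[THEN comp_subst])

lemma computes_ceval:
  assumes "computes r Q"
  obtains n where "ceval (code r) [benc x] n" "rv n = real_of_rat (Q x)" "cval (code r) x = real_of_rat (Q x)"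
proof -
  obtain n where "eval r [benc x] n" "rat_of_code n = Q x" using assms unfolding computes_def by blast
  thus ?thesis using that[of n] eval_imp_ceval cval_eq by metis
qed

lemma computes_good:
  assumes "computes r Q" "is_measure Q"
  shows "good (code r) m"
proof -
  have Q: "Q [] = 1" "Q (x @ [False]) + Q (x @ [True]) = Q x" for x
    using assms(2) unfolding is_measure_def by auto
  have "\<exists>a. ceval (code r) [0] a \<and> rle a (rnat 1)"
    using computes_ceval[OF assms(1), of "[]"] Q(1) by (metis rle_iff benc.simps(1) of_nat_1 of_rat_1 order_refl rv_rnat)
  moreover have "\<exists>a b c. ceval (code r) [k] a \<and> ceval (code r) [k + 1 * blen k] b \<and>
      ceval (code r) [k + 2 * blen k] c \<and> rle (radd b c) a" for k
  proof -
    obtain x where x: "k = benc x" using benc_surj by metis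
    obtain a b c where abc: "ceval (code r) [benc x] a" "ceval (code r) [benc (x @ [False])] b"
      "ceval (code r) [benc (x @ [True])] c"
      "rv a = real_of_rat (Q x)" "rv b = real_of_rat (Q (x @ [False]))" "rv c = real_of_rat (Q (x @ [True]))"
      using computes_ceval[OF assms(1)] by metis
    have "rv b + rv c = rv a" using abc Q(2)[of x] by (metis of_rat_add)
    thus ?thesis using abc unfolding x by (intro exI[of _ a] exI[of _ b] exI[of _ c]) (auto simp: benc_snoc rle_iff)
  qed
  ultimately show ?thesis unfolding good_def by blast
qed

text \<open>Cuts \<open>F\<close> down to the confirmed strings \<open>A\<close>. The inequality for
  \<open>F\<close> has to be known only where some child is confirmed; elsewhere both children
  contribute 0.\<close>

lemma semimeasure_restrict:
  assumes "\<And>x. 0 \<le> F x" "A [] \<Longrightarrow> F [] \<le> 1"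
    and "\<And>x b. A (x @ [b]) \<Longrightarrow> A x \<and> F (x @ [False]) + F (x @ [True]) \<le> F x"
  shows "semimeasure (\<lambda>x. if A x then F x else 0)"
  unfolding semimeasure_def
proof (intro conjI allI)
  fix x
  show "(if A (x @ [False]) then F (x @ [False]) else 0) + (if A (x @ [True]) then F (x @ [True]) else 0)
     \<le> (if A x then F x else 0)"
  proof (cases "\<exists>b. A (x @ [b])")
    case True
    hence "A x" "F (x @ [False]) + F (x @ [True]) \<le> F x" using assms(3) by auto
    thus ?thesis using assms(1)[of "x @ [False]"] assms(1)[of "x @ [True]"] by auto
  qed (use assms(1)[of x] in auto)
qed (use assms in auto)

section \<open>Kraft's inequality and domination of single programs\<close>

definition halting_weight :: "nat \<Rightarrow> nat \<Rightarrow> real" where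
  "halting_weight u i = (if \<exists>e. ceval u [i] e then 1 / real (blen i) else 0)"

lemma halting_weight_nonneg: "0 \<le> halting_weight u i"
  by (simp add: halting_weight_def)

lemma semimeasure_uniform: "semimeasure (\<lambda>x. 1 / 2 ^ length x)"
  by (simp add: semimeasure_def)

text \<open>The domain of a prefix-free machine is an antichain, so the claim is
  \<open>semimeasure_antichain\<close> for the uniform measure at the empty word.\<close>

lemma kraft:
  assumes "prefix_free_machine (run r)"
  shows "(\<Sum>i<N. halting_weight (code r) i) \<le> 1"
proof -
  define A where "A = {p. benc p < N \<and> run r p \<noteq> None}"
  have A_image: "benc ` A = {i. i < N \<and> (\<exists>e. ceval (code r) [i] e)}"
  proof -
    have "run r p \<noteq> None \<longleftrightarrow> (\<exists>e. ceval (code r) [benc p] e)" for p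
      using run_iff[of r p] benc_surj unfolding eval_iff_ceval by (metis not_None_eq)
    thus ?thesis unfolding A_def using benc_surj by (auto simp: image_iff) metis
  qed
  have inj: "inj_on benc A" by (auto intro: inj_onI)
  have "finite (benc ` A)" unfolding A_image by simp
  hence fin: "finite A" using inj finite_imageD by blast
  have "(\<Sum>i<N. halting_weight (code r) i) = (\<Sum>i\<in>benc ` A. 1 / real (blen i))"
    unfolding A_image by (rule sum.mono_neutral_cong_right) (auto simp: halting_weight_def)
  also have "\<dots> = (\<Sum>p\<in>A. 1 / 2 ^ length p)" by (simp add: sum.reindex[OF inj])
  also have "\<dots> \<le> 1 / 2 ^ length ([] :: bool list)"
    by (rule semimeasure_antichain[OF semimeasure_uniform fin])
       (use assms in \<open>auto simp: A_def prefix_free_machine_def\<close>)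
  finally show ?thesis by simp
qed

text \<open>Both components of a pair code are at most the code, so the sum is part of the product
  of two Kraft sums.\<close>

lemma kraft_pairs:
  assumes "prefix_free_machine (run r)"
  shows "(\<Sum>i<N. halting_weight (code r) (pfst i) * halting_weight (code r) (psnd i)) \<le> 1"
proof -
  let ?h = "halting_weight (code r)"
  have le: "pfst i \<le> i" "psnd i \<le> i" for i
    using le_prod_encode_1[of "pfst i" "psnd i"] le_prod_encode_2[of "psnd i" "pfst i"] by simp_all
  have inj: "inj_on (\<lambda>i. (pfst i, psnd i)) {..<N}"
    by (rule inj_onI) (metis Pair_inject pair_collapse)
  have "(\<Sum>i<N. ?h (pfst i) * ?h (psnd i)) = (\<Sum>(a, b)\<in>(\<lambda>i. (pfst i, psnd i)) ` {..<N}. ?h a * ?h b)"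
    by (simp add: sum.reindex[OF inj])
  also have "\<dots> \<le> (\<Sum>(a, b)\<in>{..<N} \<times> {..<N}. ?h a * ?h b)"
    by (rule sum_mono2) (use le in \<open>auto simp: halting_weight_nonneg intro: le_less_trans\<close>)
  also have "\<dots> = (\<Sum>a<N. ?h a) * (\<Sum>b<N. ?h b)"
    by (simp add: sum_product sum.cartesian_product)
  also have "\<dots> \<le> 1"
    using kraft[OF assms, of N] by (intro mult_le_one sum_nonneg) (auto simp: halting_weight_nonneg)
  finally show ?thesis .
qed

definition program_output :: "nat \<Rightarrow> nat \<Rightarrow> nat" where
  "program_output u i = (THE e. ceval u [i] e)"

lemma program_output_eq: "ceval u [i] e \<Longrightarrow> program_output u i = e"
  unfolding program_output_def using ceval_det by (metis the_equality)

text \<open>The family is indexed by inputs \<open>i\<close> of the machine, weighted by their Kraft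
  weights; outputs of the machine are read as program codes. For programs of genuine measures the
  check \<open>good\<close> succeeds at every string, so nothing of such a measure is cut
  off.\<close>

lemma universal_dominates_program:
  assumes M: "universal_semimeasure M" and U: "prefix_free_machine (run ru)"
  shows "\<exists>c>0. \<forall>r p s Q x. computes r Q \<longrightarrow> is_measure Q \<longrightarrow> run ru p = Some s \<longrightarrow> benc s = code r \<longrightarrow>
    c * (real_of_rat (Q x) / 2 ^ length p) \<le> M x"
proof -
  define u where "u = code ru"
  define G where "G i m n \<longleftrightarrow> (\<exists>e. ceval u [i] e \<and> good e m \<and> ceval e [m] n)" for i m n
  define v where "v i x = (if \<exists>n. G i (benc x) n then cval (program_output u i) x else 0)" for i x
  have G1: "\<exists>c>0. \<forall>i x. c * (v i x / real (blen i)) \<le> M x"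
  proof (rule universal_dominates_family[OF M, where G=G])
    show "computable blen" by (rule comp_blen[OF comp_id])
    show "sigma1 (\<lambda>e. G (pfst e) (pfst (psnd e)) (psnd (psnd e)))"
      unfolding G_def by (intro sigma1_intros sigma1_ceval sigma1_good comp_intros)
    show "v i x = rv n" if "G i (benc x) n" for i x n
      using that program_output_eq cval_eq unfolding v_def G_def by fastforce
    show "\<exists>n. G i (benc x) n" if "v i x \<noteq> 0" for i x
      using that unfolding v_def by (auto split: if_splits)
    show sm: "semimeasure (v i)" for i
      unfolding v_def
    proof (rule semimeasure_restrict)
      show "cval (program_output u i) [] \<le> 1" if "\<exists>n. G i (benc []) n"
        using that good_Nil program_output_eq unfolding G_def by blast
      show "(\<exists>n. G i (benc x) n) \<and> cval (program_output u i) (x @ [False]) + cval (program_output u i) (x @ [True])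
           \<le> cval (program_output u i) x" if "\<exists>n. G i (benc (x @ [b])) n" for x b
        using that good_snoc[of _ x b] program_output_eq good_mono[OF _ less_imp_le[OF benc_snoc_greater]]
        unfolding G_def by metis
    qed (rule cval_nonneg)
    have "v i [] / real (blen i) \<le> halting_weight u i" for i
    proof (cases "\<exists>e. ceval u [i] e")
      case True
      thus ?thesis using sm[of i] by (auto simp: halting_weight_def semimeasure_def divide_right_mono)
    qed (auto simp: v_def G_def halting_weight_def)
    thus "(\<Sum>i<N. v i [] / real (blen i)) \<le> 1" for N
      unfolding u_def by (intro order_trans[OF sum_mono kraft[OF U]])
  qed
  have G2: "v (benc p) x = real_of_rat (Q x)"
    if h: "computes r Q" "is_measure Q" "run ru p = Some s" "benc s = code r" for r p s Q x
  proof -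
    obtain n where n: "ceval (code r) [benc x] n" "cval (code r) x = real_of_rat (Q x)"
      using computes_ceval[OF h(1)] by metis
    have u: "ceval u [benc p] (code r)" using h(3,4) unfolding run_iff u_def eval_iff_ceval by simp
    have "G (benc p) (benc x) n" unfolding G_def using u n computes_good h(1,2) by blast
    thus ?thesis unfolding v_def using n program_output_eq[OF u] by auto
  qed
  obtain c where "0 < c" "\<And>i x. c * (v i x / real (blen i)) \<le> M x" using G1 by blast
  thus ?thesis using G2 by (intro exI[of _ c]) (metis blen_benc of_nat_numeral of_nat_power)
qed

section \<open>The semimeasure with averaged conditional probabilities\<close>

fun mixture_rev :: "(bool list \<Rightarrow> real) \<Rightarrow> (bool list \<Rightarrow> real) \<Rightarrow> bool list \<Rightarrow> real" where
  "mixture_rev P Q [] = 1"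
| "mixture_rev P Q (b # ys) =
     (P (rev (b # ys)) / P (rev ys) + Q (rev (b # ys)) / Q (rev ys)) * (mixture_rev P Q ys / 2)"

text \<open>Conditional probabilities concern the last symbol, which structural recursion sees first
  only in the reversed word.\<close>

definition mixture :: "(bool list \<Rightarrow> real) \<Rightarrow> (bool list \<Rightarrow> real) \<Rightarrow> bool list \<Rightarrow> real" where
  "mixture P Q x = mixture_rev P Q (rev x)"

lemma mixture_Nil [simp]: "mixture P Q [] = 1"
  by (simp add: mixture_def)

lemma mixture_snoc: "mixture P Q (x @ [b]) = (P (x @ [b]) / P x + Q (x @ [b]) / Q x) * (mixture P Q x / 2)"
  by (simp add: mixture_def)

lemma mixture_nonneg:
  assumes "\<And>x. 0 \<le> P x" "\<And>x. 0 \<le> Q x"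
  shows "0 \<le> mixture P Q x"
  by (induction x rule: rev_induct) (auto simp: mixture_snoc assms)

text \<open>The conditional probabilities of the two children sum to at most 1 for \<open>P\<close>
  and for \<open>Q\<close>, also where a denominator is zero, since such quotients are 0. Hence so
  does their average.\<close>

lemma mixture_snoc_le:
  assumes nn: "\<And>x. 0 \<le> P x" "\<And>x. 0 \<le> Q x"
    and P: "P (x @ [False]) + P (x @ [True]) \<le> P x" and Q: "Q (x @ [False]) + Q (x @ [True]) \<le> Q x"
  shows "mixture P Q (x @ [False]) + mixture P Q (x @ [True]) \<le> mixture P Q x"
proof -
  have *: "(a + b) / c \<le> 1" if "a + b \<le> c" "0 \<le> c" for a b c :: real
    using that by (cases "c = 0") (auto simp: divide_le_eq_1)
  have "mixture P Q (x @ [False]) + mixture P Q (x @ [True]) =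
    ((P (x @ [False]) + P (x @ [True])) / P x + (Q (x @ [False]) + Q (x @ [True])) / Q x) * (mixture P Q x / 2)"
    unfolding mixture_snoc by (simp add: algebra_simps add_divide_distrib)
  also have "\<dots> \<le> (1 + 1) * (mixture P Q x / 2)"
    using mixture_nonneg[of P Q x] nn by (intro mult_right_mono add_mono * P Q) auto
  finally show ?thesis by simp
qed

definition mixture_step :: "nat \<Rightarrow> nat \<Rightarrow> nat \<Rightarrow> nat \<Rightarrow> nat \<Rightarrow> nat" where
  "mixture_step a a' b b' t = rmul (radd (rmul a' (rinv a)) (rmul b' (rinv b))) (rmul t (rinv (rnat 2)))"

lemma rv_mixture_step: "rv (mixture_step a a' b b' t) = (rv a' / rv a + rv b' / rv b) * (rv t / 2)"
  by (simp only: mixture_step_def rv_rmul rv_radd rv_rinv rv_rnat divide_inverse of_nat_numeral)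

lemma comp_mixture_step:
  "computable f \<Longrightarrow> computable g \<Longrightarrow> computable h \<Longrightarrow> computable k \<Longrightarrow> computable l \<Longrightarrow>
    computable (\<lambda>x. mixture_step (f x) (g x) (h x) (k x) (l x))"
  unfolding mixture_step_def by (intro comp_rat comp_basic)

text \<open>T tabulates the mixture of the functions computed by e and f on all strings with code up to m.\<close>
definition mixture_table :: "nat \<Rightarrow> nat \<Rightarrow> nat \<Rightarrow> nat \<Rightarrow> bool" where
  "mixture_table e f m T \<longleftrightarrow> nthc T 0 = rnat 1 \<and>
     (\<forall>k < m. \<forall>d < 2. m < k + Suc d * blen k \<or>
        (\<exists>a a' b b'. ceval e [k] a \<and> ceval e [k + Suc d * blen k] a' \<and>
           ceval f [k] b \<and> ceval f [k + Suc d * blen k] b' \<and>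
           nthc T (k + Suc d * blen k) = mixture_step a a' b b' (nthc T k)))"

lemma sigma1_mixture_table:
  assumes "computable f" "computable g" "computable h" "computable k"
  shows "sigma1 (\<lambda>e. mixture_table (f e) (g e) (h e) (k e))"
  unfolding mixture_table_def
  by (intro sigma1_intros sigma1_ceval comp_intros comp_rat comp_blen comp_mixture_step assms[THEN comp_subst])

lemma mixture_table_mono: "mixture_table e f m T \<Longrightarrow> m' \<le> m \<Longrightarrow> mixture_table e f m' T"
  unfolding mixture_table_def by (meson leI le_less_trans less_le_trans)

lemma mixture_table_eq:
  assumes "mixture_table e f m T"
  shows "benc x \<le> m \<Longrightarrow> rv (nthc T (benc x)) = mixture (cval e) (cval f) x"
proof (induction x rule: rev_induct)
  case Nil
  thus ?case using assms by (simp add: mixture_table_def)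
next
  case (snoc b x)
  define d :: nat where "d = (if b then 1 else 0)"
  have child: "benc (x @ [b]) = benc x + Suc d * blen (benc x)" by (simp add: benc_snoc d_def)
  have lt: "benc x < m" using benc_snoc_greater[of x b] snoc.prems by simp
  have "d < 2" by (simp add: d_def)
  hence "m < benc (x @ [b]) \<or> (\<exists>a a' b0 b'. ceval e [benc x] a \<and> ceval e [benc (x @ [b])] a' \<and>
           ceval f [benc x] b0 \<and> ceval f [benc (x @ [b])] b' \<and>
           nthc T (benc (x @ [b])) = mixture_step a a' b0 b' (nthc T (benc x)))"
    using assms lt unfolding mixture_table_def child by blast
  with snoc.prems obtain a a' b0 b' where *: "ceval e [benc x] a" "ceval e [benc (x @ [b])] a'"
           "ceval f [benc x] b0" "ceval f [benc (x @ [b])] b'"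
           "nthc T (benc (x @ [b])) = mixture_step a a' b0 b' (nthc T (benc x))"
    by (meson not_le)
  have IH: "rv (nthc T (benc x)) = mixture (cval e) (cval f) x" using snoc.IH lt by simp
  show ?case unfolding *(5) rv_mixture_step mixture_snoc IH *(1-4)[THEN cval_eq] ..
qed

lemma mixture_table_exists:
  assumes e: "\<And>x. ceval e [benc x] (ne x)" and f: "\<And>x. ceval f [benc x] (nf x)"
  shows "\<exists>T. mixture_table e f m T"
proof -
  \<comment> \<open>The list argument is the reversed word, so \<open>rev (b # ys)\<close> is the
    child of \<open>rev ys\<close>.\<close>
  define t where "t = rec_list (rnat 1) (\<lambda>b ys. mixture_step (ne (rev ys)) (ne (rev (b # ys))) (nf (rev ys)) (nf (rev (b # ys))))"
  define tc where "tc x = t (rev x)" for x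
  have tc: "tc [] = rnat 1" "tc (x @ [b]) = mixture_step (ne x) (ne (x @ [b])) (nf x) (nf (x @ [b])) (tc x)" for x b
    by (simp_all add: tc_def t_def)
  obtain T where T: "\<And>k. k \<le> m \<Longrightarrow> nthc T k = tc (inv benc k)"
    using sequence_code[of m "\<lambda>k. tc (inv benc k)"] by blast
  have inv: "inv benc (benc x) = x" for x by (rule inv_f_f) (auto intro: injI)
  have T': "nthc T (benc x) = tc x" if "benc x \<le> m" for x using T[OF that] inv by simp
  have "\<exists>a a' b b'. ceval e [k] a \<and> ceval e [k + Suc d * blen k] a' \<and>
           ceval f [k] b \<and> ceval f [k + Suc d * blen k] b' \<and>
           nthc T (k + Suc d * blen k) = mixture_step a a' b b' (nthc T k)"
    if kd: "d < 2" "k + Suc d * blen k \<le> m" for k d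
  proof -
    obtain x where x: "k = benc x" using benc_surj by metis
    have child: "k + Suc d * blen k = benc (x @ [d = 1])"
      using kd(1) by (auto simp: x benc_snoc less_2_cases_iff)
    have "nthc T (benc (x @ [d = 1])) = tc (x @ [d = 1])" "nthc T (benc x) = tc x"
      using T'[of "x @ [d = 1]"] T'[of x] kd(2) benc_snoc_greater[of x "d = 1"] unfolding child by auto
    thus ?thesis using e f tc(2) unfolding child unfolding x by metis
  qed
  moreover have "nthc T 0 = rnat 1" using T'[of "[]"] tc(1) by simp
  ultimately show ?thesis unfolding mixture_table_def by (meson not_le)
qed

lemma computes_ceval_fun:
  assumes "computes r Q"
  obtains n where "\<And>x. ceval (code r) [benc x] (n x)" "\<And>x. cval (code r) x = real_of_rat (Q x)"
proof -
  have "\<forall>x. \<exists>n. ceval (code r) [benc x] n \<and> cval (code r) x = real_of_rat (Q x)"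
    using computes_ceval[OF assms] by blast
  thus ?thesis using that by metis
qed

text \<open>Here the family is indexed by pairs of inputs, whose weights multiply; this is where the
  cost K(P) + K(Q) of the mixture comes from. The table \<open>T\<close> is part of the Sigma_1
  witness, because a value of the mixture depends on both programs at all prefixes.\<close>

lemma universal_dominates_mixture:
  assumes M: "universal_semimeasure M" and U: "prefix_free_machine (run ru)"
  shows "\<exists>c>0. \<forall>r p s P r' p' s' Q x. computes r P \<longrightarrow> is_measure P \<longrightarrow> run ru p = Some s \<longrightarrow> benc s = code r \<longrightarrow>
    computes r' Q \<longrightarrow> is_measure Q \<longrightarrow> run ru p' = Some s' \<longrightarrow> benc s' = code r' \<longrightarrow>
    c * (mixture (\<lambda>x. real_of_rat (P x)) (\<lambda>x. real_of_rat (Q x)) x / (2 ^ length p * 2 ^ length p')) \<le> M x"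
proof -
  define u where "u = code ru"
  define w where "w i = blen (pfst i) * blen (psnd i)" for i
  define G where "G i m n \<longleftrightarrow> (\<exists>e f T. ceval u [pfst i] e \<and> ceval u [psnd i] f \<and> good e m \<and> good f m \<and>
    mixture_table e f m T \<and> n = nthc T m)" for i m n
  define F where "F i = mixture (cval (program_output u (pfst i))) (cval (program_output u (psnd i)))" for i
  define v where "v i x = (if \<exists>n. G i (benc x) n then F i x else 0)" for i x
  have G1: "\<exists>c>0. \<forall>i x. c * (v i x / real (w i)) \<le> M x"
  proof (rule universal_dominates_family[OF M, where G=G])
    show "computable w" unfolding w_def by (intro comp_blen comp_basic)
    show "sigma1 (\<lambda>e. G (pfst e) (pfst (psnd e)) (psnd (psnd e)))"
      unfolding G_def by (intro sigma1_intros sigma1_ceval sigma1_good sigma1_mixture_table comp_intros)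
    show "v i x = rv n" if "G i (benc x) n" for i x n
      using that program_output_eq mixture_table_eq unfolding v_def G_def F_def by fastforce
    show "\<exists>n. G i (benc x) n" if "v i x \<noteq> 0" for i x
      using that unfolding v_def by (auto split: if_splits)
    show sm: "semimeasure (v i)" for i
      unfolding v_def
    proof (rule semimeasure_restrict)
      show "0 \<le> F i x" for x unfolding F_def by (rule mixture_nonneg[OF cval_nonneg cval_nonneg])
      show "F i [] \<le> 1" by (simp add: F_def)
      fix x b assume "\<exists>n. G i (benc (x @ [b])) n"
      then obtain e f T where *: "ceval u [pfst i] e" "ceval u [psnd i] f" "good e (benc (x @ [b]))" "good f (benc (x @ [b]))"
         "mixture_table e f (benc (x @ [b])) T" unfolding G_def by blast
      have le: "benc x \<le> benc (x @ [b])" using benc_snoc_greater by (rule less_imp_le)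
      have "G i (benc x) (nthc T (benc x))" unfolding G_def
        using * good_mono[OF _ le] mixture_table_mono[OF _ le] by blast
      moreover have "F i (x @ [False]) + F i (x @ [True]) \<le> F i x"
        unfolding F_def program_output_eq[OF *(1)] program_output_eq[OF *(2)]
        by (intro mixture_snoc_le cval_nonneg good_snoc(1)[OF *(3)] good_snoc(1)[OF *(4)])
      ultimately show "(\<exists>n. G i (benc x) n) \<and> F i (x @ [False]) + F i (x @ [True]) \<le> F i x" by blast
    qed
    have "v i [] / real (w i) \<le> halting_weight u (pfst i) * halting_weight u (psnd i)" for i
    proof (cases "(\<exists>e. ceval u [pfst i] e) \<and> (\<exists>e. ceval u [psnd i] e)")
      case True
      thus ?thesis using sm[of i] by (auto simp: halting_weight_def w_def semimeasure_def divide_right_mono)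
    qed (auto simp: v_def G_def halting_weight_def)
    thus "(\<Sum>i<N. v i [] / real (w i)) \<le> 1" for N
      unfolding u_def by (intro order_trans[OF sum_mono kraft_pairs[OF U]])
  qed
  have G2: "v (prod_encode (benc p, benc p')) x = mixture (\<lambda>x. real_of_rat (P x)) (\<lambda>x. real_of_rat (Q x)) x"
    if h: "computes r P" "is_measure P" "run ru p = Some s" "benc s = code r"
      "computes r' Q" "is_measure Q" "run ru p' = Some s'" "benc s' = code r'" for r p s P r' p' s' Q x
  proof -
    obtain n where n: "\<And>x. ceval (code r) [benc x] (n x)" "\<And>x. cval (code r) x = real_of_rat (P x)"
      using computes_ceval_fun[OF h(1)] by blast
    obtain n' where n': "\<And>x. ceval (code r') [benc x] (n' x)" "\<And>x. cval (code r') x = real_of_rat (Q x)"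
      using computes_ceval_fun[OF h(5)] by blast
    have u: "ceval u [benc p] (code r)" "ceval u [benc p'] (code r')"
      using h(3,4,7,8) unfolding run_iff u_def eval_iff_ceval by simp_all
    obtain T where "mixture_table (code r) (code r') (benc x) T"
      using mixture_table_exists[OF n(1) n'(1)] by blast
    hence "G (prod_encode (benc p, benc p')) (benc x) (nthc T (benc x))"
      unfolding G_def using u computes_good[OF h(1,2)] computes_good[OF h(5,6)]
      by (intro exI[of _ "code r"] exI[of _ "code r'"] exI[of _ T]) simp
    moreover have "cval (code r) = (\<lambda>x. real_of_rat (P x))" "cval (code r') = (\<lambda>x. real_of_rat (Q x))"
      using n(2) n'(2) by blast+
    ultimately show ?thesis
      unfolding v_def F_def using program_output_eq[OF u(1)] program_output_eq[OF u(2)] by auto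
  qed
  obtain c where c: "0 < c" "\<And>i x. c * (v i x / real (w i)) \<le> M x" using G1 by blast
  have w_eq: "real (w (prod_encode (benc p, benc p'))) = 2 ^ length p * 2 ^ length p'" for p p'
    by (simp add: w_def)
  show ?thesis
  proof (intro exI[of _ c] conjI allI impI c(1))
    fix r p s P r' p' s' Q x
    assume "computes r P" "is_measure P" "run ru p = Some s" "benc s = code r"
      "computes r' Q" "is_measure Q" "run ru p' = Some s'" "benc s' = code r'"
    from G2[OF this, of x]
    show "c * (mixture (\<lambda>x. real_of_rat (P x)) (\<lambda>x. real_of_rat (Q x)) x / (2 ^ length p * 2 ^ length p')) \<le> M x"
      using c(2)[of "prod_encode (benc p, benc p')" x] unfolding w_eq by simp
  qed
qed

section \<open>Randomness and bounded deficiency\<close>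

lemma is_measure_semimeasure: "is_measure P \<Longrightarrow> semimeasure (\<lambda>x. real_of_rat (P x))"
  unfolding is_measure_def semimeasure_def by (auto simp flip: of_rat_add)

text \<open>Send each \<open>a\<close> of the antichain to its shortest prefix \<open>f a\<close> in
  the set. These prefixes form an antichain again by minimality, the strings above one prefix
  \<open>c\<close> have total measure at most \<open>P c\<close>, and \<open>P c\<close> is below
  \<open>(1 / 2) ^ n * M c\<close>. The values of \<open>M\<close> on an antichain sum to at most
  \<open>M []\<close>.\<close>

lemma open_measure_le:
  assumes P: "is_measure P" and M: "semimeasure M"
  shows "open_measure P {x. 2 ^ n * real_of_rat (P x) < M x} \<le> (1 / 2) ^ n"
  unfolding open_measure_def
proof (rule cSup_least)
  let ?T = "{x. 2 ^ n * real_of_rat (P x) < M x}"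
  let ?p = "\<lambda>x. real_of_rat (P x)"
  fix s assume "s \<in> {(\<Sum>a\<in>A. ?p a) | A. finite A \<and>
      (\<forall>a\<in>A. \<forall>b\<in>A. (\<exists>w. b = a @ w) \<longrightarrow> a = b) \<and> (\<forall>a\<in>A. \<exists>w\<in>?T. \<exists>v. a = w @ v)}"
  then obtain A where s: "s = (\<Sum>a\<in>A. ?p a)" and A: "finite A"
    "\<forall>a\<in>A. \<forall>b\<in>A. (\<exists>w. b = a @ w) \<longrightarrow> a = b" "\<forall>a\<in>A. \<exists>w\<in>?T. \<exists>v. a = w @ v" by blast
  define l where "l a = (LEAST l. take l a \<in> ?T)" for a
  define f where "f a = take (l a) a" for a
  have ex: "\<exists>l. l \<le> length a \<and> take l a \<in> ?T" if a: "a \<in> A" for a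
  proof -
    obtain w v where "w \<in> ?T" "a = w @ v" using A(3) a by blast
    thus ?thesis by (intro exI[of _ "length w"]) simp
  qed
  have f_T: "f a \<in> ?T" if "a \<in> A" for a
  proof -
    from ex[OF that] have "\<exists>l. take l a \<in> ?T" by blast
    from LeastI_ex[OF this] show ?thesis unfolding f_def l_def .
  qed
  have l_le: "l a \<le> k" if "take k a \<in> ?T" for a k
    unfolding l_def using that by (rule Least_le)
  have len_f: "length (f a) = l a" if "a \<in> A" for a
    using ex[OF that] l_le[of _ a] unfolding f_def by fastforce
  have anti: "\<forall>c\<in>f ` A. \<forall>d\<in>f ` A. (\<exists>w. d = c @ w) \<longrightarrow> c = d"
  proof (intro ballI impI)
    fix c d assume "c \<in> f ` A" "d \<in> f ` A" "\<exists>w. d = c @ w"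
    then obtain a b w where ab: "c = f a" "d = f b" "a \<in> A" "b \<in> A" "d = c @ w"
      by (elim imageE exE) simp
    \<comment> \<open>A prefix of \<open>f b\<close> is a prefix of \<open>b\<close>; so
      \<open>f a\<close> competes in the minimization defining \<open>l b\<close>, which forces the
      two lengths to agree.\<close>
    have "take (l a) b = f a"
    proof -
      have "b = f b @ drop (l b) b" by (simp add: f_def)
      hence "b = f a @ (w @ drop (l b) b)" using ab(1,2,5) by (metis append_assoc)
      thus ?thesis using len_f[OF ab(3)] by (metis append_eq_conv_conj)
    qed
    hence "l b \<le> l a" using l_le f_T[OF ab(3)] by metis
    moreover have "length (f b) = length (f a) + length w" using ab(1,2,5) by (metis length_append)
    ultimately have "w = []" using len_f[OF ab(3)] len_f[OF ab(4)] by simp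
    thus "c = d" using ab by simp
  qed
  have "s = (\<Sum>c\<in>f ` A. \<Sum>a\<in>{a \<in> A. f a = c}. ?p a)"
    unfolding s by (rule sum.image_gen[OF A(1)])
  also have "\<dots> \<le> (\<Sum>c\<in>f ` A. (1 / 2) ^ n * M c)"
  proof (rule sum_mono)
    fix c assume c: "c \<in> f ` A"
    have "(\<Sum>a\<in>{a \<in> A. f a = c}. ?p a) \<le> ?p c"
    proof (rule semimeasure_antichain[OF is_measure_semimeasure[OF P]])
      show "\<forall>a\<in>{a \<in> A. f a = c}. \<exists>v. a = c @ v"
        unfolding f_def by (metis (mono_tags, lifting) append_take_drop_id mem_Collect_eq)
      show "\<forall>a\<in>{a \<in> A. f a = c}. \<forall>b\<in>{a \<in> A. f a = c}. (\<exists>w. b = a @ w) \<longrightarrow> a = b" using A(2) by simp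
    qed (use A(1) in simp)
    also have "2 ^ n * ?p c < M c" using c f_T by blast
    hence "?p c \<le> (1 / 2) ^ n * M c" by (simp add: field_simps)
    finally show "(\<Sum>a\<in>{a \<in> A. f a = c}. ?p a) \<le> (1 / 2) ^ n * M c" .
  qed
  also have "\<dots> = (1 / 2) ^ n * (\<Sum>c\<in>f ` A. M c)" by (simp add: sum_distrib_left)
  also have "\<dots> \<le> (1 / 2) ^ n * M []"
    by (intro mult_left_mono semimeasure_antichain[OF M _ anti]) (use A(1) in auto)
  also have "\<dots> \<le> (1 / 2) ^ n * 1"
    using M by (intro mult_left_mono) (auto simp: semimeasure_def)
  finally show "s \<le> (1 / 2) ^ n" by simp
qed (use exI[of _ "{}"] in auto)

text \<open>The sets where M exceeds \<open>2 ^ k * P\<close> form a Martin-Loef test: the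
  inequality is confirmed by some rational lower bound of M, and \<open>open_measure_le\<close>
  bounds the measure. A random sequence escapes one of them.\<close>

lemma mlof_random_bounded:
  assumes P: "computable_measure P" and M: "semimeasure M" "lower_semicomputable M" and R: "mlof_random P \<omega>"
  shows "\<exists>k. \<forall>n. M (pref \<omega> n) \<le> 2 ^ k * real_of_rat (P (pref \<omega> n))"
proof -
  define T where "T k = {x. 2 ^ k * real_of_rat (P x) < M x}" for k :: nat
  obtain g rM where g: "\<And>t x. \<exists>n. eval rM [t, benc x] n \<and> rat_of_code n = g t x"
    "\<And>t x. real_of_rat (g t x) \<le> M x" "\<And>x e. 0 < e \<Longrightarrow> \<exists>t. M x - e < real_of_rat (g t x)"
    using M(2) unfolding lower_semicomputable_def by blast
  obtain rP where rP: "\<And>x. \<exists>n. eval rP [benc x] n \<and> rat_of_code n = P x"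
    using P unfolding computable_measure_def computes_def by blast
  \<comment> \<open>As \<open>benc\<close> is onto, the programs are total on all numbers and thus
    usable in the closure lemmas.\<close>
  have "\<forall>t m. \<exists>n. eval rM [t, m] n \<and> (\<forall>x. m = benc x \<longrightarrow> rat_of_code n = g t x)"
    using g(1) benc_surj benc_inj by metis
  then obtain h where h: "\<And>t m. eval rM [t, m] (h t m)" "\<And>t x. rat_of_code (h t (benc x)) = g t x" by metis
  have "\<forall>m. \<exists>n. eval rP [m] n \<and> (\<forall>x. m = benc x \<longrightarrow> rat_of_code n = P x)"
    using rP benc_surj benc_inj by metis
  then obtain q where q: "\<And>m. eval rP [m] (q m)" "\<And>x. rat_of_code (q (benc x)) = P x" by metis
  have "sigma1 (\<lambda>e. \<exists>t. \<not> rle (h t (psnd e)) (rmul (rnat (2 ^ pfst e)) (q (psnd e))))"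
    by (intro sigma1_ex sigma1_dec[OF dec_not[OF dec_rle]] comp_rat comp_power2 comp_basic
          comp_binary[OF h(1)] comp_unary[OF q(1)])
  from sigma1_domain[OF this] obtain r where
    r: "\<And>e. (\<exists>t. \<not> rle (h t (psnd e)) (rmul (rnat (2 ^ pfst e)) (q (psnd e)))) \<longleftrightarrow> (\<exists>y. eval r [e] y)" by blast
  have T_iff: "x \<in> T k \<longleftrightarrow> (\<exists>t. \<not> rle (h t (benc x)) (rmul (rnat (2 ^ k)) (q (benc x))))" for x k
  proof -
    have "x \<in> T k \<longleftrightarrow> (\<exists>t. 2 ^ k * real_of_rat (P x) < real_of_rat (g t x))"
      using g(2)[of _ x] g(3)[of "M x - 2 ^ k * real_of_rat (P x)" x] unfolding T_def
      by (auto intro: less_le_trans)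
    thus ?thesis by (simp add: rle_iff h q not_le)
  qed
  have Cn_iff: "(\<exists>y. eval (Cn r [pair_recf]) [k, m] y) \<longleftrightarrow> (\<exists>y. eval r [prod_encode (k, m)] y)" for k m
  proof
    assume "\<exists>y. eval (Cn r [pair_recf]) [k, m] y"
    then obtain y ys where "list_all2 (\<lambda>g y. eval g [k, m] y) [pair_recf] ys" "eval r ys y"
      by (auto elim: eval.cases)
    then obtain y' where "eval pair_recf [k, m] y'" "eval r [y'] y"
      by (auto simp: list_all2_Cons1)
    thus "\<exists>y. eval r [prod_encode (k, m)] y" using eval_det[OF eval_pair] by blast
  qed (use eval_CnI1[OF eval_pair] in blast)
  have "x \<in> T k \<longleftrightarrow> (\<exists>y. eval (Cn r [pair_recf]) [k, benc x] y)" for k x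
    unfolding T_iff Cn_iff r[symmetric] by simp
  moreover have "open_measure P (T k) \<le> (1 / 2) ^ k" for k
    unfolding T_def using P M(1) by (intro open_measure_le) (auto simp: computable_measure_def)
  ultimately have "mlof_test P T" unfolding mlof_test_def by blast
  hence "\<not> (\<forall>n. \<exists>k. pref \<omega> k \<in> T n)" using R unfolding mlof_random_def by blast
  thus ?thesis unfolding T_def by (auto simp: not_less)
qed

section \<open>Prediction by best explanations\<close>

text \<open>The \<open>LEAST\<close> in \<open>KQ\<close> is meaningful only if the optimal machine
  can print a code for \<open>Q\<close>. Optimality is applied to a machine with constant output;
  its component \<open>Mn (Pr 1)\<close> diverges on every input except 0, the code of the empty
  program, so it is trivially prefix-free.\<close>

lemma KQ_attained:
  assumes U: "optimal_machine U" and Q: "computable_measure Q"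
  shows "\<exists>r p s. computes r Q \<and> benc s = code r \<and> U p = Some s \<and> length p = KQ U Q"
proof -
  obtain r where r: "computes r Q" using Q unfolding computable_measure_def by blast
  obtain s where s: "benc s = code r" using benc_surj by blast
  obtain c where c: "\<And>x. eval c [x] (benc s)" using comp_const unfolding computable_def by blast
  \<comment> \<open>This machine halts on the empty program only.\<close>
  define V where "V = run (Cn c [Mn (Pr 1)])"
  have dom: "p = []" if "V p \<noteq> None" for p
  proof -
    obtain y where "eval (Cn c [Mn (Pr 1)]) [benc p] y" using \<open>V p \<noteq> None\<close> run_iff unfolding V_def by blast
    then obtain ys where "list_all2 (\<lambda>g y. eval g [benc p] y) [Mn (Pr 1)] ys" by (auto elim: eval.cases)
    then obtain n where "eval (Mn (Pr 1)) [benc p] n" by (auto simp: list_all2_Cons1)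
    hence "eval (Pr 1) [n, benc p] 0" by (auto elim: eval.cases)
    hence "benc p = benc []" by (auto elim: eval.cases)
    thus ?thesis by (simp only: benc_inj)
  qed
  have "eval (Mn (Pr 1)) [0] 0" by (auto intro!: ev_mu eval_PrI)
  hence V: "V [] = Some s" unfolding V_def run_iff using c by (auto intro: eval_CnI1)
  have "prefix_free_machine V" unfolding prefix_free_machine_def using dom V_def by metis
  then obtain p where "U p = Some s" using U V unfolding optimal_machine_def by blast
  hence "\<exists>k r p s. computes r Q \<and> benc s = code r \<and> U p = Some s \<and> length p = k" using r s by blast
  from LeastI_ex[OF this] show ?thesis unfolding KQ_def .
qed

text \<open>With mean m, p q / m^2 = 1 - (p - q)^2 / (4 m^2). Apply ln t <= t - 1, use m <= 1, and
  halve: this gives the constant 1/8.\<close>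

lemma ln_mean_ge:
  fixes p q :: real
  assumes p: "0 < p" "p \<le> 1" and q: "0 < q" "q \<le> 1"
  shows "(ln p + ln q) / 2 + (p - q)\<^sup>2 / 8 \<le> ln ((p + q) / 2)"
proof -
  define m where "m = (p + q) / 2"
  have m: "0 < m" "m \<le> 1" using assms by (auto simp: m_def)
  have "p * q = m\<^sup>2 - (p - q)\<^sup>2 / 4"
    by (simp add: m_def field_simps power2_eq_square)
  hence eq: "p * q / m\<^sup>2 = 1 - (p - q)\<^sup>2 / 4 / m\<^sup>2"
    using m by (simp add: diff_divide_distrib)
  have "ln p + ln q - 2 * ln m = ln (p * q / m\<^sup>2)"
    using p q m by (simp add: ln_div ln_mult ln_realpow)
  also have "\<dots> \<le> p * q / m\<^sup>2 - 1" using p q m by (intro ln_le_minus_one) auto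
  also have "\<dots> = - ((p - q)\<^sup>2 / 4 / m\<^sup>2)" using eq by simp
  also have "\<dots> \<le> - ((p - q)\<^sup>2 / 4)"
  proof -
    have "m\<^sup>2 \<le> 1" using m by (simp add: power_le_one)
    hence "(p - q)\<^sup>2 / 4 / 1 \<le> (p - q)\<^sup>2 / 4 / m\<^sup>2" using m by (intro divide_left_mono) auto
    thus ?thesis by simp
  qed
  finally have "ln p + ln q - 2 * ln m \<le> - ((p - q)\<^sup>2 / 4)" .
  moreover have "(a + b) / 2 + z / 8 \<le> t" if "a + b - 2 * t \<le> - (z / 4)" for a b z t :: real
    using that by (simp add: field_simps)
  ultimately show ?thesis unfolding m_def by blast
qed

lemma pref_Suc: "pref \<omega> (Suc n) = pref \<omega> n @ [\<omega> n]"
  by (simp add: pref_def)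

lemma pref_0 [simp]: "pref \<omega> 0 = []"
  by (simp add: pref_def)

lemma measure_pref_pos:
  assumes P: "is_measure P" and "0 < P (pref \<omega> n)" "k \<le> n"
  shows "0 < P (pref \<omega> k)"
proof -
  have nn: "0 \<le> P x" and eq: "P (x @ [False]) + P (x @ [True]) = P x" for x
    using P unfolding is_measure_def by auto
  have "P (pref \<omega> (Suc k)) \<le> P (pref \<omega> k)" for k
    using eq[of "pref \<omega> k"] nn[of "pref \<omega> k @ [False]"] nn[of "pref \<omega> k @ [True]"]
    unfolding pref_Suc by (cases "\<omega> k") auto
  hence "P (pref \<omega> n) \<le> P (pref \<omega> k)" by (rule lift_Suc_antimono_le) fact
  thus ?thesis using assms by simp
qed

lemma cond_bounds:
  assumes "is_measure P" "0 < P x"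
  shows "0 \<le> cond P b x" "cond P b x \<le> 1" "cond P True x = 1 - cond P False x"
proof -
  have nn: "0 \<le> real_of_rat (P y)" for y using assms(1) unfolding is_measure_def by simp
  have eq: "real_of_rat (P (x @ [False])) + real_of_rat (P (x @ [True])) = real_of_rat (P x)"
    using assms(1) unfolding is_measure_def by (metis of_rat_add)
  show "cond P True x = 1 - cond P False x" "0 \<le> cond P b x"
    using eq nn assms(2) unfolding cond_def by (auto simp: field_simps)
  have "real_of_rat (P (x @ [b])) \<le> real_of_rat (P x)"
    using eq nn[of "x @ [False]"] nn[of "x @ [True]"] by (cases b; simp only:; linarith)
  thus "cond P b x \<le> 1" using assms(2) unfolding cond_def by simp
qed

abbreviation (input) sq_dist :: "(bool list \<Rightarrow> rat) \<Rightarrow> (bool list \<Rightarrow> rat) \<Rightarrow> bool list \<Rightarrow> real" where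
  "sq_dist Q P x \<equiv> (cond Q False x - cond P False x)\<^sup>2"

lemma sq_dist_le_1:
  assumes "is_measure P" "0 < P x" "is_measure Q" "0 < Q x"
  shows "sq_dist Q P x \<le> 1"
proof -
  have "\<bar>cond Q False x - cond P False x\<bar> \<le> 1"
    using cond_bounds(1,2)[OF assms(1,2), of False] cond_bounds(1,2)[OF assms(3,4), of False] by linarith
  thus ?thesis by (simp add: abs_square_le_1)
qed

text \<open>All three logarithms are sums over the conditional probabilities along the sequence, so
  \<open>ln_mean_ge\<close> is added up step by step.\<close>

lemma ln_mixture_ge:
  assumes P: "is_measure P" and Q: "is_measure Q"
  shows "0 < P (pref \<omega> n) \<Longrightarrow> 0 < Q (pref \<omega> n) \<Longrightarrow>
    0 < mixture (\<lambda>x. real_of_rat (P x)) (\<lambda>x. real_of_rat (Q x)) (pref \<omega> n) \<and>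
    (ln (real_of_rat (P (pref \<omega> n))) + ln (real_of_rat (Q (pref \<omega> n)))) / 2 + (\<Sum>k<n. sq_dist Q P (pref \<omega> k)) / 8
    \<le> ln (mixture (\<lambda>x. real_of_rat (P x)) (\<lambda>x. real_of_rat (Q x)) (pref \<omega> n))"
proof (induction n)
  case 0
  thus ?case using P Q by (simp add: is_measure_def)
next
  case (Suc n)
  define x b where "x = pref \<omega> n" and "b = \<omega> n"
  have Sx: "pref \<omega> (Suc n) = x @ [b]" by (simp add: x_def b_def pref_Suc)
  have pos: "0 < P x" "0 < Q x" unfolding x_def
    using measure_pref_pos[OF P Suc.prems(1)] measure_pref_pos[OF Q Suc.prems(2)] by simp_all
  define p q where "p = cond P b x" and "q = cond Q b x"
  have pb: "real_of_rat (P (x @ [b])) = p * real_of_rat (P x)" "real_of_rat (Q (x @ [b])) = q * real_of_rat (Q x)"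
    using pos by (auto simp: p_def q_def cond_def)
  have "0 < P (x @ [b])" "0 < Q (x @ [b])" using Suc.prems unfolding Sx by simp_all
  hence pq: "0 < p" "p \<le> 1" "0 < q" "q \<le> 1"
    using pos cond_bounds(2)[OF P pos(1)] cond_bounds(2)[OF Q pos(2)] unfolding p_def q_def by (auto simp: cond_def)
  \<comment> \<open>The squared distance is stated for the symbol 0 but is the same for 1, as the
    two conditional probabilities are complementary.\<close>
  have sq: "sq_dist Q P x = (p - q)\<^sup>2"
    unfolding p_def q_def
    by (cases b) (simp_all add: cond_bounds(3)[OF P pos(1)] cond_bounds(3)[OF Q pos(2)] power2_commute)
  let ?m = "mixture (\<lambda>x. real_of_rat (P x)) (\<lambda>x. real_of_rat (Q x))"
  have m: "?m (x @ [b]) = (p + q) / 2 * ?m x"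
    unfolding mixture_snoc p_def q_def cond_def by simp
  have IH: "0 < ?m x" "(ln (real_of_rat (P x)) + ln (real_of_rat (Q x))) / 2 + (\<Sum>k<n. sq_dist Q P (pref \<omega> k)) / 8 \<le> ln (?m x)"
    using Suc.IH pos unfolding x_def by simp_all
  have lnm: "ln (?m (x @ [b])) = ln ((p + q) / 2) + ln (?m x)"
    unfolding m using pq IH(1) by (intro ln_mult_pos) auto
  have lnp: "ln (real_of_rat (P (x @ [b]))) = ln p + ln (real_of_rat (P x))"
    "ln (real_of_rat (Q (x @ [b]))) = ln q + ln (real_of_rat (Q x))"
    unfolding pb using pq pos by (simp_all add: ln_mult_pos)
  have "0 < ?m (x @ [b])" unfolding m using pq IH(1) by auto
  moreover have "(\<Sum>k<Suc n. sq_dist Q P (pref \<omega> k)) = (\<Sum>k<n. sq_dist Q P (pref \<omega> k)) + (p - q)\<^sup>2"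
    by (simp add: sq flip: x_def)
  ultimately show ?case unfolding Sx lnm lnp using IH(2) ln_mean_ge[OF pq] by (simp add: field_simps)
qed

section \<open>Counting explanations and summing over them\<close>

lemma computes_unique:
  assumes "computes r P" "computes r Q"
  shows "P = Q"
proof
  fix x
  have "cval (code r) x = real_of_rat (P x)" using computes_ceval[OF assms(1), of x] by blast
  moreover have "cval (code r) x = real_of_rat (Q x)" using computes_ceval[OF assms(2), of x] by blast
  ultimately show "P x = Q x" by simp
qed

lemma computes_code_unique: "code r = code r' \<Longrightarrow> computes r P \<Longrightarrow> computes r' Q \<Longrightarrow> P = Q"
proof -
  assume "code r = code r'" "computes r P" "computes r' Q"
  hence "computes r Q" unfolding computes_def eval_iff_ceval by simp
  thus "P = Q" using \<open>computes r P\<close> computes_unique by blast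
qed

text \<open>A shortest program of the machine determines the code it prints, and that code
  determines the measure. So there are no more measures than binary strings of length at most
  X.\<close>

lemma card_low_complexity:
  assumes U: "optimal_machine U" and F: "\<And>Q. Q \<in> F \<Longrightarrow> computable_measure Q \<and> real (KQ U Q) \<le> X"
    and X: "0 \<le> X"
  shows "finite F" "real (card F) \<le> 2 * 2 powr X"
proof -
  have "\<forall>Q\<in>F. \<exists>p. \<exists>r s. computes r Q \<and> benc s = code r \<and> U p = Some s \<and> length p = KQ U Q"
    using KQ_attained[OF U] F by blast
  then obtain p where p: "\<And>Q. Q \<in> F \<Longrightarrow> \<exists>r s. computes r Q \<and> benc s = code r \<and> U (p Q) = Some s \<and> length (p Q) = KQ U Q"
    by metis
  have inj: "inj_on (\<lambda>Q. benc (p Q)) F"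
  proof (rule inj_onI)
    fix Q Q' assume Q: "Q \<in> F" "Q' \<in> F" "benc (p Q) = benc (p Q')"
    then obtain r s r' s' where "computes r Q" "benc s = code r" "U (p Q) = Some s"
       "computes r' Q'" "benc s' = code r'" "U (p Q') = Some s'" using p by meson
    moreover have "p Q = p Q'" using Q(3) by simp
    ultimately show "Q = Q'" using computes_code_unique[of r r' Q Q'] by simp
  qed
  define k where "k = nat \<lfloor>X\<rfloor>"
  have sub: "(\<lambda>Q. benc (p Q)) ` F \<subseteq> {..<2 * 2 ^ k}"
  proof safe
    fix Q assume Q: "Q \<in> F"
    have "length (p Q) = KQ U Q" using p[OF Q] by blast
    moreover have "KQ U Q \<le> k" using F[OF Q] unfolding k_def by (simp add: le_nat_iff le_floor_iff)
    ultimately have "(2::nat) * 2 ^ length (p Q) \<le> 2 * 2 ^ k" by (simp add: power_increasing)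
    thus "benc (p Q) < 2 * 2 ^ k" using benc_bounds[of "p Q"] by linarith
  qed
  show "finite F" using finite_subset[OF sub] inj finite_imageD by blast
  have "card F \<le> 2 * 2 ^ k" using card_mono[OF _ sub] card_image[OF inj] by simp
  hence "real (card F) \<le> real (2 * 2 ^ k)" by (rule of_nat_mono)
  also have "\<dots> = 2 * 2 powr real k" by (simp add: powr_realpow)
  also have "\<dots> \<le> 2 * 2 powr X" using X by (simp add: k_def)
  finally show "real (card F) \<le> 2 * 2 powr X" .
qed

lemma universal_dominates_measure:
  assumes U: "optimal_machine U" and M: "universal_semimeasure M"
  shows "\<exists>c>0. \<forall>Q x. computable_measure Q \<longrightarrow> c * (real_of_rat (Q x) / 2 ^ KQ U Q) \<le> M x"
proof -
  obtain ru where "U = run ru" "prefix_free_machine (run ru)"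
    using U unfolding optimal_machine_def prefix_free_machine_def by blast
  then obtain c where "0 < c" and c: "\<And>r p s Q x. computes r Q \<Longrightarrow> is_measure Q \<Longrightarrow> U p = Some s \<Longrightarrow> benc s = code r \<Longrightarrow>
    c * (real_of_rat (Q x) / 2 ^ length p) \<le> M x" using universal_dominates_program[OF M] by blast
  have "c * (real_of_rat (Q x) / 2 ^ KQ U Q) \<le> M x" if Q: "computable_measure Q" for Q x
  proof -
    obtain r p s where "computes r Q" "benc s = code r" "U p = Some s" and p: "length p = KQ U Q"
      using KQ_attained[OF U Q] by blast
    thus ?thesis using c[of r Q p s x] Q unfolding computable_measure_def p[symmetric] by blast
  qed
  thus ?thesis using \<open>0 < c\<close> by blast
qed

lemma universal_dominates_measure_mixture:
  assumes U: "optimal_machine U" and M: "universal_semimeasure M"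
  shows "\<exists>c>0. \<forall>P Q x. computable_measure P \<longrightarrow> computable_measure Q \<longrightarrow>
    c * (mixture (\<lambda>x. real_of_rat (P x)) (\<lambda>x. real_of_rat (Q x)) x / (2 ^ KQ U P * 2 ^ KQ U Q)) \<le> M x"
proof -
  obtain ru where "U = run ru" "prefix_free_machine (run ru)"
    using U unfolding optimal_machine_def prefix_free_machine_def by blast
  then obtain c where "0 < c" and c: "\<And>r p s P r' p' s' Q x. computes r P \<Longrightarrow> is_measure P \<Longrightarrow> U p = Some s \<Longrightarrow> benc s = code r \<Longrightarrow>
    computes r' Q \<Longrightarrow> is_measure Q \<Longrightarrow> U p' = Some s' \<Longrightarrow> benc s' = code r' \<Longrightarrow>
    c * (mixture (\<lambda>x. real_of_rat (P x)) (\<lambda>x. real_of_rat (Q x)) x / (2 ^ length p * 2 ^ length p')) \<le> M x"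
    using universal_dominates_mixture[OF M] by blast
  have "c * (mixture (\<lambda>x. real_of_rat (P x)) (\<lambda>x. real_of_rat (Q x)) x / (2 ^ KQ U P * 2 ^ KQ U Q)) \<le> M x"
    if P: "computable_measure P" and Q: "computable_measure Q" for P Q x
  proof -
    obtain r p s where p: "computes r P" "benc s = code r" "U p = Some s" "length p = KQ U P"
      using KQ_attained[OF U P] by blast
    obtain r' p' s' where p': "computes r' Q" "benc s' = code r'" "U p' = Some s'" "length p' = KQ U Q"
      using KQ_attained[OF U Q] by blast
    have "is_measure P" "is_measure Q" using P Q unfolding computable_measure_def by auto
    from c[OF p(1) this(1) p(3,2) p'(1) this(2) p'(3,2), of x] show ?thesis unfolding p p' .
  qed
  thus ?thesis using \<open>0 < c\<close> by blast
qed

text \<open>A real supremum is an upper bound only if the set is bounded; randomness supplies the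
  bound. The \<open>+ 1\<close> pays for the ceiling in \<open>KA\<close>. The last claim is the
  deficiency of the empty prefix: it keeps D from falling below a constant depending on M
  alone.\<close>

lemma seq_defic_bounds:
  assumes M: "universal_semimeasure M" "\<And>x. 0 < M x" and P: "computable_measure P" and R: "mlof_random P \<omega>"
  shows "0 < P (pref \<omega> n)"
    and "ln (M (pref \<omega> n)) \<le> (seq_defic M P \<omega> + 1) * ln 2 + ln (real_of_rat (P (pref \<omega> n)))"
    and "- real_of_int (KA M []) \<le> seq_defic M P \<omega>"
proof -
  obtain k where k: "\<And>n. M (pref \<omega> n) \<le> 2 ^ k * real_of_rat (P (pref \<omega> n))"
    using mlof_random_bounded[OF P _ _ R] M(1) unfolding universal_semimeasure_def by blast
  have pos: "0 < real_of_rat (P (pref \<omega> n))" for n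
    using less_le_trans[OF M(2) k, of n] by (simp add: zero_less_mult_iff)
  thus "0 < P (pref \<omega> n)" by simp
  have le: "defic M P (pref \<omega> n) \<le> k" for n
  proof -
    have "log 2 (M (pref \<omega> n)) \<le> log 2 (2 ^ k * real_of_rat (P (pref \<omega> n)))"
      using k[of n] M(2)[of "pref \<omega> n"] pos[of n] by simp
    also have "\<dots> = k + log 2 (real_of_rat (P (pref \<omega> n)))"
      using pos[of n] by (simp add: log_mult)
    finally show ?thesis unfolding defic_def KA_def
      using le_of_int_ceiling[of "- log 2 (M (pref \<omega> n))"] by linarith
  qed
  have bdd: "bdd_above (range (\<lambda>n. defic M P (pref \<omega> n)))" by (rule bdd_aboveI2[OF le])
  have D: "defic M P (pref \<omega> n) \<le> seq_defic M P \<omega>" for n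
    unfolding seq_defic_def by (rule cSUP_upper[OF _ bdd]) simp
  show "- real_of_int (KA M []) \<le> seq_defic M P \<omega>"
    using D[of 0] P by (simp add: defic_def computable_measure_def is_measure_def)
  have "log 2 (M (pref \<omega> n)) \<le> seq_defic M P \<omega> + 1 + log 2 (real_of_rat (P (pref \<omega> n)))"
    using D[of n] ceiling_correct[of "- log 2 (M (pref \<omega> n))"] unfolding defic_def KA_def by linarith
  hence "log 2 (M (pref \<omega> n)) * ln 2 \<le> (seq_defic M P \<omega> + 1 + log 2 (real_of_rat (P (pref \<omega> n)))) * ln 2"
    by (intro mult_right_mono) auto
  thus "ln (M (pref \<omega> n)) \<le> (seq_defic M P \<omega> + 1) * ln 2 + ln (real_of_rat (P (pref \<omega> n)))"
    by (simp add: log_def algebra_simps)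
qed

text \<open>Each group is enlarged to all indices up to its largest member, which is harmless as
  \<open>h\<close> is nonnegative; \<open>B\<close> bounds exactly this larger sum.\<close>

lemma sum_le_card_groups:
  fixes f :: "nat \<Rightarrow> real"
  assumes g: "\<And>n m. g n = g m \<Longrightarrow> f m = h (g n) m" and hn: "\<And>y n. 0 \<le> h y n"
    and B: "\<And>n. (\<Sum>k\<le>n. h (g n) k) \<le> B"
  shows "(\<Sum>n<N. f n) \<le> real (card (g ` {..<N})) * B"
proof -
  have "(\<Sum>n<N. f n) = (\<Sum>y\<in>g ` {..<N}. \<Sum>n\<in>{n \<in> {..<N}. g n = y}. f n)"
    by (rule sum.image_gen) simp
  also have "\<dots> \<le> (\<Sum>y\<in>g ` {..<N}. B)"
  proof (rule sum_mono)
    fix y assume "y \<in> g ` {..<N}"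
    define A where "A = {n \<in> {..<N}. g n = y}"
    have A: "finite A" "A \<noteq> {}" using \<open>y \<in> g ` {..<N}\<close> by (auto simp: A_def)
    have m: "g (Max A) = y" using Max_in[OF A] by (simp add: A_def)
    have "sum f A = sum (h y) A" by (rule sum.cong) (auto simp: A_def g)
    also have "\<dots> \<le> (\<Sum>k\<le>Max A. h y k)" by (rule sum_mono2) (use A hn in auto)
    also have "\<dots> \<le> B" using B[of "Max A"] m by simp
    finally show "sum f A \<le> B" .
  qed
  finally show ?thesis by simp
qed

lemma best_expl_bounds:
  assumes cA: "0 < cA" "\<forall>Q x. computable_measure Q \<longrightarrow> cA * (real_of_rat (Q x) / 2 ^ KQ U Q) \<le> M x"
    and cB: "0 < cB" "\<forall>P Q x. computable_measure P \<longrightarrow> computable_measure Q \<longrightarrow>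
      cB * (mixture (\<lambda>x. real_of_rat (P x)) (\<lambda>x. real_of_rat (Q x)) x / (2 ^ KQ U P * 2 ^ KQ U Q)) \<le> M x"
    and M: "universal_semimeasure M" "\<And>x. 0 < M x" and P: "computable_measure P" and R: "mlof_random P \<omega>"
    and Q: "best_expl U (pref \<omega> n) Q"
  defines "K \<equiv> real (KQ U P)" and "D \<equiv> seq_defic M P \<omega>"
  shows "real (KQ U Q) \<le> (3 * K + D + (1 - log 2 cA)) / 2"
    and "(\<Sum>k\<le>n. sq_dist Q P (pref \<omega> k)) \<le> 8 * ((D + 1 + 5 / 2 * K) * ln 2 - ln cB) + 1"
proof -
  define x where "x = pref \<omega> n"
  define p q where "p = real_of_rat (P x)" and "q = real_of_rat (Q x)"
  define k where "k = real (KQ U Q)"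
  have Pm: "is_measure P" and Qm: "computable_measure Q" "is_measure Q" and Qpos: "0 < Q x"
    using P Q unfolding computable_measure_def best_expl_def x_def by auto
  have Ppos: "0 < P x" unfolding x_def by (rule seq_defic_bounds(1)[OF M P R])
  have p: "0 < p" and q: "0 < q" using Ppos Qpos by (auto simp: p_def q_def)
  have D: "ln (M x) \<le> (D + 1) * ln 2 + ln p"
    unfolding D_def p_def x_def by (rule seq_defic_bounds(2)[OF M P R])
  have "3 * k - log 2 q \<le> 3 * K - log 2 p"
    using Q Ppos P unfolding best_expl_def expl_score_def x_def p_def q_def k_def K_def by blast
  hence "(3 * k - log 2 q) * ln 2 \<le> (3 * K - log 2 p) * ln 2" by (intro mult_right_mono) auto
  hence score: "3 * (k * ln 2) - ln q \<le> 3 * (K * ln 2) - ln p" by (simp add: log_def algebra_simps)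
  have "ln (cA * (q / 2 ^ KQ U Q)) \<le> ln (M x)"
    using cA(2)[rule_format, OF Qm(1), of x] cA(1) q M(2)[of x] unfolding q_def by simp
  hence A: "ln cA + ln q - k * ln 2 \<le> ln (M x)"
    using cA(1) q by (simp add: ln_mult_pos ln_div ln_realpow k_def)
  have "2 * (k * ln 2) \<le> 3 * (K * ln 2) + (D + 1) * ln 2 - ln cA" using A D score by linarith
  hence "2 * k * ln 2 \<le> (3 * K + D + (1 - log 2 cA)) * ln 2" by (simp add: log_def algebra_simps)
  hence "2 * k \<le> 3 * K + D + (1 - log 2 cA)" by (subst (asm) mult_le_cancel_right_pos) auto
  thus "real (KQ U Q) \<le> (3 * K + D + (1 - log 2 cA)) / 2" by (simp add: k_def)
  define m where "m = mixture (\<lambda>x. real_of_rat (P x)) (\<lambda>x. real_of_rat (Q x)) x"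
  have m: "0 < m" "(ln p + ln q) / 2 + (\<Sum>k<n. sq_dist Q P (pref \<omega> k)) / 8 \<le> ln m"
    using ln_mixture_ge[OF Pm Qm(2), of \<omega> n] Ppos Qpos unfolding m_def p_def q_def x_def by auto
  have "ln (cB * (m / (2 ^ KQ U P * 2 ^ KQ U Q))) \<le> ln (M x)"
    using cB(2)[rule_format, OF P Qm(1), of x] cB(1) m(1) M(2)[of x] unfolding m_def by simp
  hence B: "ln cB + ln m - (K * ln 2 + k * ln 2) \<le> ln (M x)"
    using cB(1) m(1) by (simp add: ln_mult_pos ln_div ln_realpow k_def K_def)
  have "0 \<le> k * ln 2" by (simp add: k_def)
  \<comment> \<open>Here \<open>s \<le> d + K' + k' - c + (p' - q') / 2\<close>, and the score
    bounds the last term by \<open>3 / 2 * (K' - k')\<close>. The remaining \<open>- k' / 2\<close>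
    is dropped.\<close>
  moreover have "s \<le> d + 5 / 2 * K' - c"
    if "0 \<le> k'" "c + m' - (K' + k') \<le> M'" "M' \<le> d + p'" "3 * k' - q' \<le> 3 * K' - p'" "(p' + q') / 2 + s \<le> m'"
    for s d K' c k' m' M' p' q' :: real
    using that by (simp add: field_simps)
  ultimately have "(\<Sum>k<n. sq_dist Q P (pref \<omega> k)) / 8 \<le> (D + 1) * ln 2 + 5 / 2 * (K * ln 2) - ln cB"
    using B D score m(2) by blast
  \<comment> \<open>The mixture at \<open>x\<close> records only predictions made at proper
    prefixes; the prediction at \<open>x\<close> itself contributes the extra
    \<open>+ 1\<close>.\<close>
  moreover have "sq_dist Q P x \<le> 1" by (rule sq_dist_le_1[OF Pm Ppos Qm(2) Qpos])
  ultimately show "(\<Sum>k\<le>n. sq_dist Q P (pref \<omega> k)) \<le> 8 * ((D + 1 + 5 / 2 * K) * ln 2 - ln cB) + 1"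
    by (simp add: x_def algebra_simps flip: lessThan_Suc_atMost)
qed

theorem theorem7:
  fixes U :: "bool list \<Rightarrow> bool list option"
    and M :: "bool list \<Rightarrow> real"
    and Hexpl :: "bool list \<Rightarrow> (bool list \<Rightarrow> rat)"
  assumes "optimal_machine U"
    and "universal_semimeasure M"
    and "\<forall>x. best_expl U x (Hexpl x)"
  shows "\<exists>c1 c2 :: real. \<forall>P \<omega>. computable_measure P \<and> mlof_random P \<omega> \<longrightarrow>
     (let K = real (KQ U P); D = seq_defic M P \<omega>;
          f = (\<lambda>n. (cond (Hexpl (pref \<omega> n)) False (pref \<omega> n) - cond P False (pref \<omega> n))\<^sup>2)
      in summable f \<and> suminf f \<le> c1 * max 1 (K + D) * 2 powr ((3 * K + D + c2) / 2))"
proof -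
  obtain cA where cA: "0 < cA"
    "\<forall>Q x. computable_measure Q \<longrightarrow> cA * (real_of_rat (Q x) / 2 ^ KQ U Q) \<le> M x"
    using universal_dominates_measure[OF assms(1,2)] by blast
  obtain cB where cB: "0 < cB"
    "\<forall>P Q x. computable_measure P \<longrightarrow> computable_measure Q \<longrightarrow>
      cB * (mixture (\<lambda>x. real_of_rat (P x)) (\<lambda>x. real_of_rat (Q x)) x / (2 ^ KQ U P * 2 ^ KQ U Q)) \<le> M x"
    using universal_dominates_measure_mixture[OF assms(1,2)] by blast
  \<comment> \<open>Logarithms of M require positivity. Every string has a best explanation giving
    it positive probability, and M dominates that explanation.\<close>
  have Mpos: "0 < M x" for x
  proof -
    have H: "computable_measure (Hexpl x)" "0 < Hexpl x x" using assms(3) unfolding best_expl_def by auto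
    have "0 < cA * (real_of_rat (Hexpl x x) / 2 ^ KQ U (Hexpl x))" using cA(1) H(2) by simp
    thus ?thesis using cA(2)[rule_format, OF H(1), of x] by linarith
  qed
  define d where "d = \<bar>real_of_int (KA M [])\<bar>"
  \<comment> \<open>The per-explanation bound equals
    \<open>20 * ln 2 * (K + D) - 12 * (D * ln 2)\<close> plus constants, where 20 is 8 times 5/2. As
    D may be negative, the second term is bounded through \<open>- d \<le> D\<close>; the constants
    are absorbed by \<open>max 1 (K + D)\<close>.\<close>
  define C where "C = 20 * ln 2 + 12 * (d * ln 2) + 8 * ln 2 + 8 * \<bar>ln cB\<bar> + 1"
  have C: "0 \<le> C" by (simp add: C_def d_def)
  show ?thesis
  proof (rule exI[of _ "2 * C"], rule exI[of _ "1 - log 2 cA"], intro allI impI, elim conjE)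
    fix P \<omega> assume P: "computable_measure P" and R: "mlof_random P \<omega>"
    define K D where "K = real (KQ U P)" and "D = seq_defic M P \<omega>"
    define f where "f n = sq_dist (Hexpl (pref \<omega> n)) P (pref \<omega> n)" for n
    define X where "X = (3 * K + D + (1 - log 2 cA)) / 2"
    define B where "B = 8 * ((D + 1 + 5 / 2 * K) * ln 2 - ln cB) + 1"
    note bounds = best_expl_bounds[OF cA cB assms(2) Mpos P R, folded K_def D_def]
    have KX: "real (KQ U (Hexpl (pref \<omega> n))) \<le> X" for n
      unfolding X_def by (rule bounds(1)[OF assms(3)[rule_format]])
    have sumB: "(\<Sum>k\<le>n. sq_dist (Hexpl (pref \<omega> n)) P (pref \<omega> k)) \<le> B" for n
      unfolding B_def by (rule bounds(2)[OF assms(3)[rule_format]])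
    have X: "0 \<le> X" using KX[of 0] by linarith
    have B0: "0 \<le> B" using order_trans[OF sum_nonneg sumB[of 0]] by simp
    have "- d \<le> D" using seq_defic_bounds(3)[OF assms(2) Mpos P R] unfolding D_def d_def by linarith
    hence dD: "- (d * ln 2) \<le> D * ln 2" using mult_right_mono[of "- d" D "ln 2"] by simp
    have mono: "20 * ln 2 * (K + D) \<le> 20 * ln 2 * max 1 (K + D)" by (intro mult_left_mono) auto
    have "B = 20 * ln 2 * (K + D) - 12 * (D * ln 2) + 8 * ln 2 - 8 * ln cB + 1"
      by (simp add: B_def algebra_simps)
    also have "\<dots> \<le> 20 * ln 2 * max 1 (K + D) + (12 * (d * ln 2) + 8 * ln 2 + 8 * \<bar>ln cB\<bar> + 1) * 1"
      unfolding mult_1_right using dD mono abs_ge_minus_self[of "ln cB"] by linarith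
    also have "\<dots> \<le> 20 * ln 2 * max 1 (K + D) + (12 * (d * ln 2) + 8 * ln 2 + 8 * \<bar>ln cB\<bar> + 1) * max 1 (K + D)"
      by (intro add_left_mono mult_left_mono) (auto simp: d_def)
    also have "\<dots> = C * max 1 (K + D)" by (simp add: C_def algebra_simps)
    finally have BC: "B \<le> C * max 1 (K + D)" .
    have sum_le: "(\<Sum>n<N. f n) \<le> 2 * C * max 1 (K + D) * 2 powr X" for N
    proof -
      let ?F = "(\<lambda>n. Hexpl (pref \<omega> n)) ` {..<N}"
      have "(\<Sum>n<N. f n) \<le> real (card ?F) * B"
        by (rule sum_le_card_groups[where h="\<lambda>Q n. sq_dist Q P (pref \<omega> n)"]) (use sumB in \<open>auto simp: f_def\<close>)
      also have "\<dots> \<le> (2 * 2 powr X) * (C * max 1 (K + D))"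
      proof (intro mult_mono BC B0)
        show "real (card ?F) \<le> 2 * 2 powr X"
          by (rule card_low_complexity(2)[OF assms(1) _ X]) (use KX assms(3) in \<open>auto simp: best_expl_def\<close>)
      qed auto
      finally show ?thesis by (simp add: mult_ac)
    qed
    have "summable f" by (rule summableI_nonneg_bounded[OF _ sum_le]) (simp add: f_def)
    moreover from this have "suminf f \<le> 2 * C * max 1 (K + D) * 2 powr X" by (rule suminf_le_const[OF _ sum_le])
    ultimately show "let K = real (KQ U P); D = seq_defic M P \<omega>;
          f = (\<lambda>n. (cond (Hexpl (pref \<omega> n)) False (pref \<omega> n) - cond P False (pref \<omega> n))\<^sup>2)
      in summable f \<and> suminf f \<le> 2 * C * max 1 (K + D) * 2 powr ((3 * K + D + (1 - log 2 cA)) / 2)"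
      unfolding Let_def K_def D_def f_def X_def by blast
  qed
qed

end
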